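(* Let $k\ge 1$, $\varepsilon>0$, and let $\mathcal W$ be a family of channels with input alphabet $[2k]$. The sample complexity of $(2k,\varepsilon)$-uniformity testing under local constraints $\mathcal W$ using sequentially interactive protocols is \[ \Omega\!\left(\frac{k}{\varepsilon^2\sqrt{\|\mathcal W\|_{\mathrm{op}}\,\|\mathcal W\|_\ast}}\right). \]
   Context: A channel $W\colon[2k]\to\mathcal Y$ ($\mathcal Y$ finite or countable) is a Markov kernel $W(y\mid x)$. A sequentially interactive protocol with $n$ users using $\mathcal W$: $X_1,\dots,X_n$ i.i.d. from an unknown distribution $p$ on $[2k]$; $U$ a public random variable independent of the $X_i$; user $t$ selects $W_t\in\mathcal W$ as a function of $(Y_1,\dots,Y_{t-1},U)$ and outputs $Y_t\sim W_t(\cdot\mid X_t)$. An $(n,\varepsilon)$-test for uniformity is such a protocol together with a randomized decision $T(Y^n,U)\in\{0,1\}$ such that $\Pr[T=0]\ge 99/100$ when $p$ is the uniform distribution $u$ on $[2k]$, and $\Pr[T=1]\ge 99/100$ for every $p$ with $d_{TV}(p,u)\ge\varepsilon$, where $d_{TV}(p_1,p_2)=\sup_S(p_1(S)-p_2(S))$. The sample complexity is the least $n$ for which an $(n,\varepsilon)$-test exists. The channel information matrix of $W$ is the $k\times k$ matrix \[ H(W)_{i_1,i_2}=\sum_{y\in\mathcal Y}\frac{(W(y\mid 2i_1-1)-W(y\mid 2i_1))(W(y\mid 2i_2-1)-W(y\mid 2i_2))}{\sum_{x\in[2k]}W(y\mid x)} \] (sum over $y$ with positive denominator); $\|\mathcal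 W\|_{\mathrm{op}}=\sup_{W\in\mathcal W}\|H(W)\|_{\mathrm{op}}$ and $\|\mathcal W\|_\ast=\sup_{W\in\mathcal W}\|H(W)\|_\ast$ (operator and nuclear norms). $f=\Omega(g)$ means $f\ge c\,g$ for an absolute constant $c>0$.
   Formalization: The formal statement assumes ε ≤ 1/2, since for ε > 1/2 the claim fails (e.g. k = 1: no distribution is ε-far from uniform, so 0 users suffice); outputs are natural numbers and the public randomness U takes values in a probability space on the reals. *)

theory Defs
  imports
    "HOL-Probability.Probability"
    "Jordan_Normal_Form.Char_Poly"
begin

section \<open>Matrix norms\<close>

definition op_norm :: "real Matrix.mat \<Rightarrow> real" where
  "op_norm A =
    (SUP v \<in> {v \<in> carrier_vec (dim_col A). scalar_prod v v = 1}.
       sqrt (scalar_prod (A *\<^sub>v v) (A *\<^sub>v v)))"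

text \<open>The sum of the singular values, i.e. of the square roots of the eigenvalues of
  \<open>A\<^sup>T A\<close> counted with algebraic multiplicity (all of them are real and nonnegative).\<close>

definition nuclear_norm :: "real Matrix.mat \<Rightarrow> real" where
  "nuclear_norm A =
    (let q = char_poly (transpose_mat A * A)
     in \<Sum>x | poly q x = 0. real (order x q) * sqrt x)"


section \<open>Channels\<close>

text \<open>\<open>pmf (W x) y\<close> is \<open>W(y | x)\<close>. The input alphabet is \<open>{1..2 * k}\<close>; the values
  of a channel at other arguments are never used.\<close>

type_synonym 'y channel = "nat \<Rightarrow> 'y pmf"

text \<open>Matrix indices start at \<open>0\<close>, so row \<open>i\<close> belongs to the pair of
  symbols \<open>2 * i + 1\<close> and \<open>2 * i + 2\<close>.\<close>

definition channel_info_matrix :: "nat \<Rightarrow> 'y channel \<Rightarrow> real Matrix.mat" where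
  "channel_info_matrix k W = Matrix.mat k k (\<lambda>(i, j).
     \<Sum>\<^sub>\<infinity>y \<in> {y. (\<Sum>x = 1..2 * k. pmf (W x) y) > 0}.
       (pmf (W (2 * i + 1)) y - pmf (W (2 * i + 2)) y) *
       (pmf (W (2 * j + 1)) y - pmf (W (2 * j + 2)) y) /
       (\<Sum>x = 1..2 * k. pmf (W x) y))"

definition family_op_norm :: "nat \<Rightarrow> 'y channel set \<Rightarrow> ennreal" where
  "family_op_norm k \<W> = (SUP W \<in> \<W>. ennreal (op_norm (channel_info_matrix k W)))"

definition family_nuclear_norm :: "nat \<Rightarrow> 'y channel set \<Rightarrow> ennreal" where
  "family_nuclear_norm k \<W> = (SUP W \<in> \<W>. ennreal (nuclear_norm (channel_info_matrix k W)))"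

definition ennreal_sqrt :: "ennreal \<Rightarrow> ennreal" where
  "ennreal_sqrt x = (if x = \<top> then \<top> else ennreal (sqrt (enn2real x)))"


section \<open>Sequentially interactive protocols\<close>

text \<open>The public randomness \<open>U\<close> has law \<open>M\<close>. The channel of user \<open>t\<close> is
  \<open>sel [Y\<^sub>1, \<dots>, Y\<^sub>t\<^sub>-\<^sub>1] U\<close>, so the user's index is determined by the length of the list.\<close>

definition interactive_protocol ::
    "nat \<Rightarrow> 'y channel set \<Rightarrow> nat \<Rightarrow> 'u measure \<Rightarrow> ('y list \<Rightarrow> 'u \<Rightarrow> 'y channel) \<Rightarrow> bool" where
  "interactive_protocol k \<W> n M sel \<longleftrightarrow>
     prob_space M \<and>
     (\<forall>ys. length ys < n \<longrightarrow>
        (\<forall>u \<in> space M. sel ys u \<in> \<W>) \<and>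
        (\<forall>x \<in> {1..2 * k}. \<forall>y. (\<lambda>u. pmf (sel ys u x) y) \<in> borel_measurable M))"

text \<open>The law of \<open>(Y\<^sub>1, \<dots>, Y\<^sub>n)\<close> given \<open>U = u\<close>, when the samples are i.i.d. from \<open>p\<close>.\<close>

primrec transcript ::
    "('y list \<Rightarrow> 'u \<Rightarrow> 'y channel) \<Rightarrow> nat pmf \<Rightarrow> 'u \<Rightarrow> nat \<Rightarrow> 'y list pmf" where
  "transcript sel p u 0 = return_pmf []"
| "transcript sel p u (Suc n) =
     bind_pmf (transcript sel p u n) (\<lambda>ys.
       bind_pmf p (\<lambda>x. map_pmf (\<lambda>y. ys @ [y]) (sel ys u x)))"

text \<open>The randomized decision is a kernel \<open>dec\<close>, with \<open>True\<close> for \<open>T = 1\<close> and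
  \<open>False\<close> for \<open>T = 0\<close>.\<close>

definition decision_rule :: "nat \<Rightarrow> 'u measure \<Rightarrow> ('y list \<Rightarrow> 'u \<Rightarrow> bool pmf) \<Rightarrow> bool" where
  "decision_rule n M dec \<longleftrightarrow>
     (\<forall>ys. length ys = n \<longrightarrow> (\<forall>b. (\<lambda>u. pmf (dec ys u) b) \<in> borel_measurable M))"

definition decision_prob ::
    "nat \<Rightarrow> 'u measure \<Rightarrow> ('y list \<Rightarrow> 'u \<Rightarrow> 'y channel) \<Rightarrow> ('y list \<Rightarrow> 'u \<Rightarrow> bool pmf)
      \<Rightarrow> nat pmf \<Rightarrow> bool \<Rightarrow> real" where
  "decision_prob n M sel dec p b =
     (\<integral>u. pmf (bind_pmf (transcript sel p u n) (\<lambda>ys. dec ys u)) b \<partial>M)"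


section \<open>Uniformity testing\<close>

definition tv_dist :: "'a pmf \<Rightarrow> 'a pmf \<Rightarrow> real" where
  "tv_dist p q = (SUP S. measure_pmf.prob p S - measure_pmf.prob q S)"

definition uniformity_test ::
    "nat \<Rightarrow> real \<Rightarrow> 'y channel set \<Rightarrow> nat \<Rightarrow> 'u measure
      \<Rightarrow> ('y list \<Rightarrow> 'u \<Rightarrow> 'y channel) \<Rightarrow> ('y list \<Rightarrow> 'u \<Rightarrow> bool pmf) \<Rightarrow> bool" where
  "uniformity_test k \<epsilon> \<W> n M sel dec \<longleftrightarrow>
     interactive_protocol k \<W> n M sel \<and>
     decision_rule n M dec \<and>
     decision_prob n M sel dec (pmf_of_set {1..2 * k}) False \<ge> 99 / 100 \<and>
     (\<forall>p. set_pmf p \<subseteq> {1..2 * k} \<and> tv_dist p (pmf_of_set {1..2 * k}) \<ge> \<epsilon> \<longrightarrow>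
        decision_prob n M sel dec p True \<ge> 99 / 100)"

text \<open>The public randomness may live on any probability space whose points are real numbers, with
  an arbitrary sigma-algebra. The infimum of the empty set is \<open>\<infinity>\<close>.\<close>

definition sample_complexity :: "nat \<Rightarrow> real \<Rightarrow> 'y channel set \<Rightarrow> enat" where
  "sample_complexity k \<epsilon> \<W> =
     (INF n \<in> {n. \<exists>(M :: real measure) sel dec. uniformity_test k \<epsilon> \<W> n M sel dec}. enat n)"

end

theory Submission
  imports Defs "Jordan_Normal_Form.Schur_Decomposition"
begin

text \<open>Perturb the uniform distribution by \<open>p\<^sub>z(2i-1), p\<^sub>z(2i) = (1 \<plusminus> 2 \<epsilon> z\<^sub>i) / (2k)\<close> with a uniformly random
  sign vector \<open>z\<close>, and fix a value of the public randomness. Let \<open>r\<^sub>z\<close> be the likelihood ratio of the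
  transcript with respect to the uniform input. All divergences are taken with respect to the law
  under the uniform input, so the argument works up to \<open>\<epsilon> = 1/2\<close>, where \<open>p\<^sub>z\<close> is not bounded below.

  One round increases the divergence \<open>D\<close> of the mixture over \<open>z\<close> by at most
  \<open>(2 \<epsilon>\<^sup>2 / k) E [\<theta>\<^sup>T H \<theta>]\<close>, where \<open>\<theta>\<close> is the posterior mean of \<open>z\<close>, and the average divergence \<open>J\<close> by at
  most \<open>(2 \<epsilon>\<^sup>2 / k) E [z\<^sup>T H z]\<close>. Decomposing a posterior law on the cube into martingale differences
  shows that, if its relative entropy to the uniform law is \<open>h\<close>, then \<open>|\<theta>|\<^sup>2 \<le> 2 h\<close> and
  \<open>E [z\<^sup>T H z] \<le> 2 tr H + 4 |H|\<^sub>o\<^sub>p h\<close>. As \<open>E h = J - D \<le> J\<close>, these recursions give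
  \<open>J = O(n \<epsilon>\<^sup>2 tr H / k)\<close> and \<open>D = O(n\<^sup>2 \<epsilon>\<^sup>4 |H|\<^sub>o\<^sub>p tr H / k\<^sup>2)\<close> as long as \<open>n \<epsilon>\<^sup>2 |H|\<^sub>o\<^sub>p = O(k)\<close>, whereas
  a test forces \<open>D \<ge> 1/2\<close>.\<close>

section \<open>Trace, operator norm and nuclear norm\<close>

text \<open>At a complex eigenvector \<open>v\<close> for \<open>a\<close>, the Hermitian form of
  the matrix is \<open>a\<close> times the squared length of \<open>v\<close>. Symmetry makes this
  form real, hence \<open>a\<close> is real, and the factorization over the complex numbers descends
  to the reals because \<open>map_poly complex_of_real\<close> is injective.\<close>

lemma symmetric_char_poly_splits:
  fixes A :: "real Matrix.mat"
  assumes A: "A \<in> carrier_mat n n"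
    and sym: "\<And>i j. i < n \<Longrightarrow> j < n \<Longrightarrow> A $$ (i, j) = A $$ (j, i)"
  shows "\<exists>es. char_poly A = (\<Prod>e\<leftarrow>es. [:- e, 1:])"
proof -
  define B where "B = map_mat complex_of_real A"
  have B: "B \<in> carrier_mat n n" using A by (simp add: B_def)
  have cB: "char_poly B = map_poly complex_of_real (char_poly A)"
    unfolding B_def by (rule of_real_hom.char_poly_hom[OF A])
  obtain as where as: "char_poly B = (\<Prod>a\<leftarrow>as. [:- a, 1:])"
    using char_poly_factorized[OF B] by blast
  have real: "a \<in> \<real>" if "a \<in> set as" for a
  proof -
    have "poly (char_poly B) a = 0"
      using that unfolding as by (induction as) auto
    then have "eigenvalue B a"
      using eigenvalue_root_char_poly[OF B] by simp
    then obtain v where v: "v \<in> carrier_vec n" "v \<noteq> 0\<^sub>v n" "B *\<^sub>v v = a \<cdot>\<^sub>v v"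
      using B unfolding eigenvalue_def eigenvector_def by auto
    define s where "s = (\<Sum>i<n. \<Sum>j<n. B $$ (i, j) * v $ j * cnj (v $ i))"
    define N where "N = (\<Sum>i<n. (cmod (v $ i))\<^sup>2)"
    have "(\<Sum>j<n. B $$ (i, j) * v $ j) = a * v $ i" if "i < n" for i
    proof -
      have "(B *\<^sub>v v) $ i = (\<Sum>j<n. B $$ (i, j) * v $ j)"
        using that B v(1) by (auto simp: scalar_prod_def lessThan_atLeast0 intro!: sum.cong)
      then show ?thesis
        using that v(1) by (simp add: v(3))
    qed
    then have "s = (\<Sum>i<n. a * v $ i * cnj (v $ i))"
      unfolding s_def by (simp add: sum_distrib_right[symmetric])
    also have "\<dots> = a * of_real N"
      unfolding N_def of_real_sum sum_distrib_left
      by (intro sum.cong) (simp_all add: complex_norm_square[symmetric] mult.assoc)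
    finally have s: "s = a * of_real N" .
    have "cnj s = (\<Sum>i<n. \<Sum>j<n. B $$ (i, j) * cnj (v $ j) * v $ i)"
      unfolding s_def using A by (auto simp: B_def intro!: sum.cong)
    also have "\<dots> = (\<Sum>j<n. \<Sum>i<n. B $$ (i, j) * cnj (v $ j) * v $ i)"
      by (rule sum.swap)
    also have "\<dots> = s"
      unfolding s_def using A sym by (auto simp: B_def intro!: sum.cong)
    finally have "cnj a * of_real N = a * of_real N"
      using s by simp
    moreover have "N \<noteq> 0"
    proof
      assume "N = 0"
      then have "\<forall>i<n. v $ i = 0"
        unfolding N_def by (subst (asm) sum_nonneg_eq_0_iff) auto
      then have "v = 0\<^sub>v n"
        using v(1) by (intro eq_vecI) auto
      with v(2) show False by simp
    qed
    ultimately have "cnj a = a" by simp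
    then show ?thesis by (simp add: Reals_cnj_iff)
  qed
  interpret ph: map_poly_inj_idom_hom complex_of_real ..
  have "map_poly complex_of_real (\<Prod>e\<leftarrow>map Re as. [:- e, 1:]) = (\<Prod>a\<leftarrow>as. [:- a, 1:])"
    using real by (induction as) (auto simp: ph.hom_mult map_poly_pCons simp del: mult_pCons_left)
  then have "map_poly complex_of_real (\<Prod>e\<leftarrow>map Re as. [:- e, 1:]) = map_poly complex_of_real (char_poly A)"
    using as cB by simp
  then have "char_poly A = (\<Prod>e\<leftarrow>map Re as. [:- e, 1:])"
    by (metis ph.injectivity)
  then show ?thesis by blast
qed

lemma trace_mult_comm:
  fixes A :: "real Matrix.mat"
  assumes A: "A \<in> carrier_mat n n" and B: "B \<in> carrier_mat n n"
  shows "(\<Sum>i<n. (A * B) $$ (i, i)) = (\<Sum>i<n. (B * A) $$ (i, i))"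
proof -
  have "(\<Sum>i<n. (A * B) $$ (i, i)) = (\<Sum>i<n. \<Sum>j<n. A $$ (i, j) * B $$ (j, i))"
    using A B by (intro sum.cong) (auto simp: scalar_prod_def lessThan_atLeast0)
  also have "\<dots> = (\<Sum>j<n. \<Sum>i<n. A $$ (i, j) * B $$ (j, i))"
    by (rule sum.swap)
  also have "\<dots> = (\<Sum>i<n. (B * A) $$ (i, i))"
    using A B by (intro sum.cong) (auto simp: scalar_prod_def lessThan_atLeast0 mult.commute)
  finally show ?thesis .
qed

text \<open>Turns the sum over distinct roots in \<open>nuclear_norm\<close> into a sum over a list
  of diagonal entries: the order of a root of a split polynomial counts its occurrences among the
  linear factors.\<close>

lemma sum_order_roots_split_poly:
  fixes es :: "real list" and f :: "real \<Rightarrow> real"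
  defines "q \<equiv> (\<Prod>e\<leftarrow>es. [:- e, 1:])"
  shows "(\<Sum>x | poly q x = 0. real (Polynomial.order x q) * f x) = (\<Sum>e\<leftarrow>es. f e)"
proof -
  have roots: "{x. poly q x = 0} = set es"
    unfolding q_def by (induction es) auto
  have "Polynomial.order x (\<Prod>e\<leftarrow>es. [:- e, 1:]) = count_list es x" for x
  proof (induction es)
    case (Cons e es)
    have "(\<Prod>e\<leftarrow>es. [:- e, 1:]) \<noteq> 0"
      by (induction es) (auto simp del: mult_pCons_left)
    then have "[:- e, 1:] * (\<Prod>e\<leftarrow>es. [:- e, 1:]) \<noteq> 0"
      by (simp del: mult_pCons_left)
    then have "Polynomial.order x ([:- e, 1:] * (\<Prod>e\<leftarrow>es. [:- e, 1:])) = Polynomial.order x [:- e, 1:] + count_list es x"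
      by (simp add: order_mult Cons.IH del: mult_pCons_left)
    moreover have "Polynomial.order x [:- e, 1:] = (if e = x then 1 else 0)"
      using Polynomial.order_power_n_n[of e 1] by (auto intro!: Polynomial.order_0I)
    ultimately show ?case by (simp del: mult_pCons_left)
  qed simp
  moreover have "(\<Sum>x\<in>A. real (count_list es x) * f x) = (\<Sum>e\<leftarrow>es. f e)"
    if "finite A" "set es \<subseteq> A" for A
    using that(2)
  proof (induction es)
    case (Cons e es)
    have "(\<Sum>x\<in>A. real (count_list (e # es) x) * f x)
        = (\<Sum>x\<in>A. (if e = x then f x else 0) + real (count_list es x) * f x)"
      by (intro sum.cong) (auto simp: algebra_simps)
    then show ?case
      using Cons that(1) by (simp add: sum.distrib)
  qed simp
  ultimately show ?thesis
    by (simp add: roots q_def[symmetric])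
qed

text \<open>Let \<open>B\<close> be a Schur triangular form of \<open>A\<close>. By symmetry the
  transpose of \<open>A\<close> times \<open>A\<close> is \<open>A * A\<close>, whose eigenvalues
  are the squares of the diagonal of \<open>B\<close>. So the nuclear norm adds up the absolute
  values of the diagonal entries of \<open>B\<close>, the trace the entries themselves.\<close>

lemma trace_le_nuclear_norm:
  fixes A :: "real Matrix.mat"
  assumes A: "A \<in> carrier_mat n n"
    and sym: "\<And>i j. i < n \<Longrightarrow> j < n \<Longrightarrow> A $$ (i, j) = A $$ (j, i)"
  shows "(\<Sum>i<n. A $$ (i, i)) \<le> nuclear_norm A"
proof -
  have At: "transpose_mat A = A"
    using A sym by (intro eq_matI) auto
  obtain es where "char_poly A = (\<Prod>e\<leftarrow>es. [:- e, 1:])"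
    using symmetric_char_poly_splits[OF A sym] by blast
  then obtain B where B: "B \<in> carrier_mat n n" "upper_triangular B" and "similar_mat A B"
    using schur_decomposition_exists[OF A] by blast
  then obtain P Q where "similar_mat_wit A B P Q"
    by (auto simp: similar_mat_def)
  note PQ = similar_mat_witD2[OF A this]
  have QP: "Q * (P * X) = X" if "X \<in> carrier_mat n n" for X
    using that PQ assoc_mult_mat[of Q n n P n X n] by simp
  have "A * A = P * (B * (Q * (P * (B * Q))))"
    using B PQ(1,2,4-) by (simp add: PQ(3) assoc_mult_mat[of _ n n _ n _ n])
  also have "\<dots> = P * (B * B) * Q"
    using B PQ by (simp add: QP assoc_mult_mat[of _ n n _ n _ n])
  finally have "similar_mat (A * A) (B * B)"
    using B PQ A by (intro similar_matI[of _ _ P Q n]) auto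
  then have "char_poly (A * A) = char_poly (B * B)"
    by (rule char_poly_similar)
  \<comment> \<open>For \<open>j \<le> i\<close> only the term \<open>l = i\<close> survives:
    \<open>B $$ (i, l)\<close> vanishes for \<open>l < i\<close>, and \<open>B $$ (l, j)\<close> for
    \<open>l > i\<close>.\<close>
  moreover have BB: "(B * B) $$ (i, j) = (if i = j then (B $$ (i, i))\<^sup>2 else 0)"
    if "i < n" "j \<le> i" for i j
  proof -
    have "(B * B) $$ (i, j) = (\<Sum>l<n. B $$ (i, l) * B $$ (l, j))"
      using that B by (auto simp: scalar_prod_def lessThan_atLeast0)
    also have "\<dots> = (\<Sum>l<n. if l = i then B $$ (i, i) * B $$ (i, j) else 0)"
    proof (intro sum.cong refl)
      fix l assume "l \<in> {..<n}"
      then show "B $$ (i, l) * B $$ (l, j) = (if l = i then B $$ (i, i) * B $$ (i, j) else 0)"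
        using that B by (cases l i rule: linorder_cases) (auto simp: upper_triangular_def)
    qed
    finally show ?thesis
      using that B by (auto simp: power2_eq_square upper_triangular_def)
  qed
  moreover have "upper_triangular (B * B)"
    using B BB by (auto simp: upper_triangular_def)
  ultimately have q: "char_poly (A * A) = (\<Prod>e\<leftarrow>diag_mat (B * B). [:- e, 1:])"
    using char_poly_upper_triangular[of "B * B" n] B by simp
  have "nuclear_norm A = (\<Sum>e\<leftarrow>diag_mat (B * B). sqrt e)"
    unfolding nuclear_norm_def Let_def At q by (rule sum_order_roots_split_poly)
  also have "\<dots> = (\<Sum>i<n. \<bar>B $$ (i, i)\<bar>)"
    using B BB by (simp add: diag_mat_def interv_sum_list_conv_sum_set_nat lessThan_atLeast0 comp_def)
  also have "\<dots> \<ge> (\<Sum>i<n. B $$ (i, i))"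
    by (intro sum_mono) simp
  also have "(\<Sum>i<n. B $$ (i, i)) = (\<Sum>i<n. A $$ (i, i))"
  proof -
    have "(\<Sum>i<n. (P * (B * Q)) $$ (i, i)) = (\<Sum>i<n. (B * Q * P) $$ (i, i))"
      using B PQ by (intro trace_mult_comm) auto
    moreover have "B * Q * P = B" "P * (B * Q) = A"
      using B PQ by (simp_all add: assoc_mult_mat[of _ n n _ n _ n])
    ultimately show ?thesis by simp
  qed
  finally show ?thesis .
qed

section \<open>The operator norm as a bound for quadratic forms\<close>

lemma scalar_prod_conv_sum:
  fixes v w :: "real Matrix.vec"
  shows "w \<in> carrier_vec n \<Longrightarrow> scalar_prod v w = (\<Sum>i<n. v $ i * w $ i)"
  by (simp add: scalar_prod_def lessThan_atLeast0)

text \<open>\<open>op_norm\<close> is a real supremum, usable only over a bounded nonempty set. The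
  bilinear bound with \<open>w = A v\<close> gives \<open>|A v|^2 \<le> b |A v|\<close>, hence
  boundedness, and \<open>n > 0\<close> supplies a unit vector. The second claim follows by
  normalizing \<open>v\<close> and applying Cauchy-Schwarz.\<close>

lemma op_norm_le:
  fixes A :: "real Matrix.mat"
  assumes A: "A \<in> carrier_mat n n" and n: "n > 0" and b0: "0 \<le> b"
    and b: "\<And>v w. (\<Sum>i<n. \<Sum>j<n. w i * v j * A $$ (i, j)) \<le> b * sqrt (\<Sum>i<n. (w i)\<^sup>2) * sqrt (\<Sum>i<n. (v i)\<^sup>2)"
  shows "op_norm A \<le> b"
    and "(\<Sum>i<n. \<Sum>j<n. v i * v j * A $$ (i, j)) \<le> op_norm A * (\<Sum>i<n. (v i)\<^sup>2)"
proof -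
  let ?S = "{v :: real Matrix.vec. v \<in> carrier_vec (dim_col A) \<and> scalar_prod v v = 1}"
  let ?g = "\<lambda>v. sqrt (scalar_prod (A *\<^sub>v v) (A *\<^sub>v v))"
  have Av: "(A *\<^sub>v v) $ i = (\<Sum>j<n. A $$ (i, j) * v $ j)" if "v \<in> carrier_vec n" "i < n" for v i
    using that A by (auto simp: scalar_prod_def lessThan_atLeast0 intro!: sum.cong)
  have bnd: "?g v \<le> b" if "v \<in> ?S" for v
  proof -
    have v: "v \<in> carrier_vec n" and v1: "(\<Sum>i<n. (v $ i)\<^sup>2) = 1"
      using that A by (auto simp: scalar_prod_conv_sum[of _ n] power2_eq_square)
    define w where "w = A *\<^sub>v v"
    have w: "w \<in> carrier_vec n" using A v by (simp add: w_def)
    define s where "s = (\<Sum>i<n. (w $ i)\<^sup>2)"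
    have s0: "s \<ge> 0" unfolding s_def by (intro sum_nonneg) auto
    have gs: "?g v = sqrt s"
      unfolding w_def[symmetric] s_def using w by (simp add: scalar_prod_conv_sum[of _ n] power2_eq_square)
    have "s = (\<Sum>i<n. \<Sum>j<n. w $ i * v $ j * A $$ (i, j))"
      unfolding s_def power2_eq_square
      using Av[OF v] by (auto simp: w_def[symmetric] sum_distrib_left mult_ac intro!: sum.cong)
    also have "\<dots> \<le> b * sqrt s"
      using b[of "\<lambda>i. w $ i" "\<lambda>i. v $ i"] v1 by (simp add: s_def)
    finally have "sqrt s * sqrt s \<le> b * sqrt s" using s0 by simp
    then show ?thesis
      unfolding gs using s0 b0 mult_right_le_imp_le[of "sqrt s" "sqrt s" b] by (cases "s = 0") auto
  qed
  have "unit_vec n 0 \<in> ?S"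
    using A n by simp
  then have ne: "?S \<noteq> {}" by blast
  show "op_norm A \<le> b"
    unfolding op_norm_def by (rule cSUP_least[OF ne bnd])
  have bdd: "bdd_above (?g ` ?S)"
    using bnd by (auto simp: bdd_above_def)
  show "(\<Sum>i<n. \<Sum>j<n. v i * v j * A $$ (i, j)) \<le> op_norm A * (\<Sum>i<n. (v i)\<^sup>2)"
  proof (cases "(\<Sum>i<n. (v i)\<^sup>2) = 0")
    case True
    then have "\<forall>i<n. v i = 0"
      by (subst (asm) sum_nonneg_eq_0_iff) auto
    then show ?thesis by simp
  next
    case False
    define N where "N = sqrt (\<Sum>i<n. (v i)\<^sup>2)"
    have "(\<Sum>i<n. (v i)\<^sup>2) \<ge> 0" by (intro sum_nonneg) auto
    then have N: "N > 0" and N2: "N\<^sup>2 = (\<Sum>i<n. (v i)\<^sup>2)"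
      using False by (auto simp: N_def)
    define u where "u = Matrix.vec n (\<lambda>i. v i / N)"
    have u: "u \<in> carrier_vec n" by (simp add: u_def)
    have u1: "(\<Sum>i<n. (u $ i)\<^sup>2) = 1"
      using N by (simp add: u_def power_divide sum_divide_distrib[symmetric] N2[symmetric])
    then have "u \<in> ?S"
      using A u by (simp add: scalar_prod_conv_sum[of _ n] power2_eq_square)
    then have "?g u \<le> op_norm A"
      unfolding op_norm_def by (intro cSUP_upper bdd)
    then have Au: "L2_set (\<lambda>i. (A *\<^sub>v u) $ i) {..<n} \<le> op_norm A"
      using A u by (simp add: L2_set_def scalar_prod_conv_sum[of _ n] power2_eq_square)
    have "(\<Sum>i<n. \<Sum>j<n. v i * v j * A $$ (i, j)) = N\<^sup>2 * (\<Sum>i<n. u $ i * (A *\<^sub>v u) $ i)"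
      using N Av[OF u]
      by (auto simp: u_def sum_distrib_left power2_eq_square field_simps intro!: sum.cong)
    also have "(\<Sum>i<n. u $ i * (A *\<^sub>v u) $ i) \<le> (\<Sum>i<n. \<bar>u $ i\<bar> * \<bar>(A *\<^sub>v u) $ i\<bar>)"
      by (intro sum_mono) (simp add: abs_mult[symmetric])
    also have "\<dots> \<le> L2_set (\<lambda>i. u $ i) {..<n} * L2_set (\<lambda>i. (A *\<^sub>v u) $ i) {..<n}"
      by (rule L2_set_mult_ineq)
    also have "L2_set (\<lambda>i. u $ i) {..<n} = 1"
      using u1 by (simp add: L2_set_def)
    finally have "(\<Sum>i<n. \<Sum>j<n. v i * v j * A $$ (i, j)) \<le> N\<^sup>2 * L2_set (\<lambda>i. (A *\<^sub>v u) $ i) {..<n}"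
      using N by (simp add: mult_le_cancel_left)
    also have "\<dots> \<le> N\<^sup>2 * op_norm A"
      using Au by (intro mult_left_mono) auto
    finally show ?thesis by (simp add: N2 mult.commute)
  qed
qed

section \<open>The function \<open>x ln x\<close>\<close>

text \<open>The value at 0 is 0, the continuous extension. This matters because likelihood ratios
  may vanish when \<open>\<epsilon> = 1/2\<close>.\<close>

definition xlnx :: "real \<Rightarrow> real" where
  "xlnx x = x * ln x"

lemma xlnx_0 [simp]: "xlnx 0 = 0" and xlnx_1 [simp]: "xlnx 1 = 0"
  by (simp_all add: xlnx_def)

lemma xlnx_mult: "a > 0 \<Longrightarrow> b \<ge> 0 \<Longrightarrow> xlnx (a * b) = b * xlnx a + a * xlnx b"
  by (cases "b = 0") (auto simp: xlnx_def ln_mult algebra_simps)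

text \<open>Young's inequality for the conjugate pair \<open>x ln x - x\<close> and
  \<open>exp s\<close>, obtained from \<open>1 + t \<le> exp t\<close> at
  \<open>t = s - ln x\<close>. It later converts the success of a test into a lower bound for a
  divergence.\<close>

lemma mult_le_xlnx_exp: "x \<ge> 0 \<Longrightarrow> x * s \<le> xlnx x - x + exp s"
proof (cases "x = 0")
  case False
  assume "x \<ge> 0"
  with False have x: "x > 0" by simp
  have "x * (1 + (s - ln x)) \<le> x * exp (s - ln x)"
    using x by (intro mult_left_mono exp_ge_add_one_self) auto
  also have "\<dots> = exp s" using x by (simp add: exp_diff)
  finally show ?thesis by (simp add: xlnx_def algebra_simps)
qed simp

lemma xlnx_ge: "x \<ge> 0 \<Longrightarrow> x - 1 \<le> xlnx x"
  using mult_le_xlnx_exp[of x 0] by simp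

text \<open>The pointwise form of bounding relative entropy by chi-square divergence: the term
  linear in \<open>x - r\<close> disappears in expectation when \<open>x\<close> has mean
  \<open>r\<close>. The source is \<open>ln t \<le> t - 1\<close> at
  \<open>t = x / r\<close>.\<close>

lemma xlnx_le_quadratic:
  assumes "r > 0" "x \<ge> 0"
  shows "xlnx x \<le> xlnx r + (ln r + 1) * (x - r) + (x - r)\<^sup>2 / r"
proof (cases "x = 0")
  case True
  then show ?thesis using assms by (simp add: xlnx_def power2_eq_square algebra_simps)
next
  case False
  then have x: "x > 0" using assms by simp
  have "ln (x / r) \<le> x / r - 1"
    using x assms by (intro ln_le_minus_one) auto
  then have "x * (ln x - ln r) \<le> x * (x / r - 1)"
    using x assms by (simp add: ln_div)
  then show ?thesis
    using assms by (simp add: xlnx_def power2_eq_square field_simps)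
qed

lemma abs_xlnx_le:
  assumes "0 \<le> x" "x \<le> C"
  shows "\<bar>xlnx x\<bar> \<le> C\<^sup>2 + 1"
proof -
  have "xlnx x \<le> x * x" if "x > 0"
    unfolding xlnx_def using that ln_le_minus_one[of x] by (intro mult_left_mono) auto
  then have "xlnx x \<le> x * x"
    using assms by (cases "x = 0") auto
  moreover have "x * x \<le> C * C"
    using assms by (intro mult_mono) auto
  moreover have "- 1 \<le> xlnx x"
    using xlnx_ge[of x] assms by simp
  moreover have "0 \<le> C * C" by simp
  ultimately show ?thesis
    unfolding power2_eq_square abs_le_iff by linarith
qed

text \<open>Pinsker's inequality for a sign of mean \<open>x\<close>, whose relative entropy to a
  fair sign is half the right-hand side. The difference of the two sides and its first derivative
  vanish at 0, and its second derivative is nonnegative.\<close>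

lemma two_point_entropy_aux:
  assumes "0 \<le> x" "x < 1"
  shows "x\<^sup>2 \<le> xlnx (1 + x) + xlnx (1 - x)"
proof -
  \<comment> \<open>This says that the first derivative of the function \<open>?g\<close> below is
    nonnegative; it is proved by differentiating once more.\<close>
  have d1: "2 * y \<le> ln (1 + y) - ln (1 - y)" if "0 \<le> y" "y < 1" for y :: real
  proof -
    have "(\<lambda>y. ln (1 + y) - ln (1 - y) - 2 * y) 0 \<le> (\<lambda>y. ln (1 + y) - ln (1 - y) - 2 * y) y"
    proof (rule DERIV_nonneg_imp_nondecreasing[OF that(1)])
      fix t assume t: "0 \<le> t" "t \<le> y"
      have "((\<lambda>y. ln (1 + y) - ln (1 - y) - 2 * y) has_real_derivative
          1 / (1 + t) + 1 / (1 - t) - 2) (at t)"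
        using t that by (auto intro!: derivative_eq_intros)
      moreover have "1 / (1 + t) + 1 / (1 - t) - 2 = 2 * t\<^sup>2 / ((1 + t) * (1 - t))"
      proof -
        have "1 + t \<noteq> 0" "1 - t \<noteq> 0" using t that by auto
        then have "1 / (1 + t) + 1 / (1 - t) - 2 = (2 - 2 * ((1 + t) * (1 - t))) / ((1 + t) * (1 - t))"
          by (simp add: diff_divide_distrib add_frac_eq)
        also have "2 - 2 * ((1 + t) * (1 - t)) = 2 * t\<^sup>2"
          by (simp add: power2_eq_square algebra_simps)
        finally show ?thesis .
      qed
      moreover have "\<dots> \<ge> 0" using t that by simp
      ultimately show "\<exists>d. ((\<lambda>y. ln (1 + y) - ln (1 - y) - 2 * y) has_real_derivative d) (at t) \<and> 0 \<le> d"
        by metis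
    qed
    then show ?thesis by simp
  qed
  let ?g = "\<lambda>y. (1 + y) * ln (1 + y) + (1 - y) * ln (1 - y) - y\<^sup>2 :: real"
  have "?g 0 \<le> ?g x"
  proof (rule DERIV_nonneg_imp_nondecreasing[OF assms(1)])
    fix t assume t: "0 \<le> t" "t \<le> x"
    have "(?g has_real_derivative ln (1 + t) - ln (1 - t) - 2 * t) (at t)"
      using t assms by (auto intro!: derivative_eq_intros)
    then show "\<exists>d. (?g has_real_derivative d) (at t) \<and> 0 \<le> d"
      using d1[of t] t assms by (intro exI[of _ "ln (1 + t) - ln (1 - t) - 2 * t"] conjI) auto
  qed
  then show ?thesis by (simp add: xlnx_def)
qed

lemma two_point_entropy:
  assumes "\<bar>x\<bar> \<le> 1"
  shows "x\<^sup>2 \<le> xlnx (1 + x) + xlnx (1 - x)"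
proof -
  have "\<bar>x\<bar>\<^sup>2 \<le> xlnx (1 + \<bar>x\<bar>) + xlnx (1 - \<bar>x\<bar>)"
  proof (cases "\<bar>x\<bar> = 1")
    case True
    \<comment> \<open>At the endpoint the claim reads \<open>1 \<le> 2 * ln 2\<close>.\<close>
    have "exp (1/2::real) \<le> 2"
      using exp_bound_half[of "1/2::real"] by simp
    then have "1/2 \<le> ln (2::real)" by (subst ln_ge_iff) auto
    then show ?thesis using True by (simp add: xlnx_def)
  next
    case False
    with assms show ?thesis by (intro two_point_entropy_aux) auto
  qed
  then show ?thesis by (cases "x \<ge> 0") auto
qed

text \<open>The homogeneous version of the two-point inequality. If \<open>a\<close> and
  \<open>b\<close> are the values of a density at the two choices of one sign, then
  \<open>(a + b) / 2\<close> is the marginal density and \<open>(a - b) / (a + b)\<close> the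
  conditional mean of that sign.\<close>

lemma xlnx_midpoint:
  assumes "a \<ge> 0" "b \<ge> 0"
  shows "(a + b) / 2 * ((a - b) / (a + b))\<^sup>2 \<le> xlnx a + xlnx b - 2 * xlnx ((a + b) / 2)"
proof (cases "a + b = 0")
  case True
  then have "a = 0" "b = 0" using assms by auto
  then show ?thesis by simp
next
  case False
  define r x where "r = (a + b) / 2" and "x = (a - b) / (a + b)"
  have r: "r > 0" using False assms by (simp add: r_def)
  have ab: "a = r * (1 + x)" "b = r * (1 - x)"
    using False by (simp_all add: r_def x_def field_simps)
  have x: "\<bar>x\<bar> \<le> 1"
    using assms False by (auto simp: x_def abs_le_iff field_simps)
  have "r * x\<^sup>2 \<le> r * (xlnx (1 + x) + xlnx (1 - x))"
    using r two_point_entropy[OF x] by (intro mult_left_mono) auto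
  also have "\<dots> = xlnx a + xlnx b - 2 * xlnx r"
  proof -
    have "xlnx a = (1 + x) * xlnx r + r * xlnx (1 + x)" "xlnx b = (1 - x) * xlnx r + r * xlnx (1 - x)"
      unfolding ab using r x by (intro xlnx_mult; simp)+
    then show ?thesis by (simp add: algebra_simps)
  qed
  finally show ?thesis by (simp add: r_def x_def)
qed

section \<open>Entropy on the sign cube\<close>

text \<open>Pinning the coordinates from \<open>k\<close> on to 0 makes the set finite, and the step
  from \<open>k\<close> to \<open>Suc k\<close> becomes an update of coordinate \<open>k\<close>
  from 0 to 1 or -1.\<close>

definition sign_cube :: "nat \<Rightarrow> (nat \<Rightarrow> real) set" where
  "sign_cube k = {z. (\<forall>i<k. z i = 1 \<or> z i = - 1) \<and> (\<forall>i\<ge>k. z i = 0)}"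

definition cube_avg :: "nat \<Rightarrow> ((nat \<Rightarrow> real) \<Rightarrow> real) \<Rightarrow> real" where
  "cube_avg k f = (\<Sum>z\<in>sign_cube k. f z) / 2 ^ k"

lemma sign_cube_0: "sign_cube 0 = {\<lambda>_. 0}"
  by (auto simp: sign_cube_def)

lemma sign_cube_Suc:
  "sign_cube (Suc k) = (\<lambda>z. z(k := 1)) ` sign_cube k \<union> (\<lambda>z. z(k := - 1)) ` sign_cube k"
proof (intro equalityI subsetI)
  fix z assume z: "z \<in> sign_cube (Suc k)"
  have "z(k := 0) \<in> sign_cube k"
    using z by (auto simp: sign_cube_def)
  moreover have "z = (z(k := 0))(k := 1) \<or> z = (z(k := 0))(k := - 1)"
    using z by (auto simp: sign_cube_def fun_eq_iff)
  ultimately show "z \<in> (\<lambda>z. z(k := 1)) ` sign_cube k \<union> (\<lambda>z. z(k := - 1)) ` sign_cube k"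
    by blast
qed (auto simp: sign_cube_def less_Suc_eq)

lemma finite_sign_cube [simp]: "finite (sign_cube k)"
  by (induction k) (simp_all add: sign_cube_0 sign_cube_Suc)

lemma inj_on_upd_sign_cube: "inj_on (\<lambda>z. z(k := s)) (sign_cube k)"
proof (rule inj_onI)
  fix z w assume "z \<in> sign_cube k" "w \<in> sign_cube k" and eq: "z(k := s) = w(k := s)"
  then have "z k = w k" by (simp add: sign_cube_def)
  moreover have "z i = w i" if "i \<noteq> k" for i
    using fun_cong[OF eq, of i] that by simp
  ultimately show "z = w" by (metis ext)
qed

lemma sum_sign_cube_Suc:
  "(\<Sum>z\<in>sign_cube (Suc k). f z) = (\<Sum>z\<in>sign_cube k. f (z(k := 1)) + f (z(k := - 1)))"
proof -
  have "(\<lambda>z. z(k := 1)) ` sign_cube k \<inter> (\<lambda>z. z(k := - 1)) ` sign_cube k = {}"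
    by (auto simp: fun_eq_iff) (metis fun_upd_same one_neq_neg_one)
  then show ?thesis
    unfolding sign_cube_Suc
    by (subst sum.union_disjoint) (auto simp: sum.reindex inj_on_upd_sign_cube sum.distrib)
qed

lemma cube_avg_Suc:
  "cube_avg (Suc k) f = cube_avg k (\<lambda>z. (f (z(k := 1)) + f (z(k := - 1))) / 2)"
  by (simp add: cube_avg_def sum_sign_cube_Suc sum_divide_distrib[symmetric])

lemma cube_avg_cong: "(\<And>z. z \<in> sign_cube k \<Longrightarrow> f z = g z) \<Longrightarrow> cube_avg k f = cube_avg k g"
  by (simp add: cube_avg_def cong: sum.cong)

lemma cube_avg_mono: "(\<And>z. z \<in> sign_cube k \<Longrightarrow> f z \<le> g z) \<Longrightarrow> cube_avg k f \<le> cube_avg k g"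
  unfolding cube_avg_def by (intro divide_right_mono sum_mono) auto

lemma cube_avg_nonneg: "(\<And>z. z \<in> sign_cube k \<Longrightarrow> 0 \<le> f z) \<Longrightarrow> 0 \<le> cube_avg k f"
  unfolding cube_avg_def by (intro divide_nonneg_pos sum_nonneg) auto

lemma cube_avg_const [simp]: "cube_avg k (\<lambda>_. c) = c"
  by (induction k) (simp_all add: cube_avg_Suc, simp add: cube_avg_def sign_cube_0)

lemma abs_cube_avg_le:
  assumes "\<And>z. z \<in> sign_cube k \<Longrightarrow> \<bar>f z\<bar> \<le> B"
  shows "\<bar>cube_avg k f\<bar> \<le> B"
proof -
  have "cube_avg k f \<le> cube_avg k (\<lambda>_. B)" "cube_avg k (\<lambda>_. - B) \<le> cube_avg k f"
    using assms by (intro cube_avg_mono; fastforce simp: abs_le_iff)+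
  then show ?thesis by simp
qed

lemma cube_avg_add: "cube_avg k (\<lambda>z. f z + g z) = cube_avg k f + cube_avg k g"
  by (simp add: cube_avg_def sum.distrib add_divide_distrib)

lemma cube_avg_diff: "cube_avg k (\<lambda>z. f z - g z) = cube_avg k f - cube_avg k g"
  by (simp add: cube_avg_def sum_subtractf diff_divide_distrib)

lemma cube_avg_mult_left: "cube_avg k (\<lambda>z. c * f z) = c * cube_avg k f"
  by (simp add: cube_avg_def sum_distrib_left)

lemma cube_avg_sum: "cube_avg k (\<lambda>z. \<Sum>i\<in>I. f i z) = (\<Sum>i\<in>I. cube_avg k (f i))"
  unfolding cube_avg_def by (subst sum.swap) (simp add: sum_divide_distrib)

text \<open>With respect to the density \<open>r\<close>, \<open>m i\<close> is the conditional mean of the \<open>i\<close>-th sign given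
  the previous ones. The chain rule splits the entropy of \<open>r\<close> into the contributions of these
  conditional laws, each of which dominates half the squared conditional mean.\<close>

lemma sign_cube_martingale:
  assumes "\<And>z. z \<in> sign_cube k \<Longrightarrow> 0 \<le> r z"
  shows "\<exists>m :: nat \<Rightarrow> (nat \<Rightarrow> real) \<Rightarrow> real.
    (\<Sum>i<k. cube_avg k (\<lambda>z. r z * (m i z)\<^sup>2)) \<le> 2 * (cube_avg k (\<lambda>z. xlnx (r z)) - xlnx (cube_avg k r)) \<and>
    (\<forall>i<k. cube_avg k (\<lambda>z. r z * (z i - m i z)) = 0) \<and>
    (\<forall>i<k. cube_avg k (\<lambda>z. r z * (z i - m i z)\<^sup>2) \<le> cube_avg k r) \<and>
    (\<forall>i<k. \<forall>j<i. cube_avg k (\<lambda>z. r z * ((z i - m i z) * (z j - m j z))) = 0)"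
  using assms
proof (induction k arbitrary: r)
  case 0
  show ?case by (simp add: cube_avg_def sign_cube_0)
next
  case (Suc k)
  \<comment> \<open>The induction peels off the last sign: \<open>p\<close> and \<open>q\<close> are
    the two slices of the density, and \<open>r'\<close> is the marginal density of the first
    \<open>k\<close> signs.\<close>
  define p q where "p z = r (z(k := 1))" and "q z = r (z(k := - 1))" for z
  define r' where "r' z = (p z + q z) / 2" for z
  have pq: "0 \<le> p z" "0 \<le> q z" if "z \<in> sign_cube k" for z
    using Suc.prems that by (auto simp: p_def q_def sign_cube_Suc)
  have "0 \<le> r' z" if "z \<in> sign_cube k" for z
    using pq[OF that] by (simp add: r'_def)
  then obtain m' where
    m1: "(\<Sum>i<k. cube_avg k (\<lambda>z. r' z * (m' i z)\<^sup>2)) \<le> 2 * (cube_avg k (\<lambda>z. xlnx (r' z)) - xlnx (cube_avg k r'))"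
    and m2: "\<And>i. i < k \<Longrightarrow> cube_avg k (\<lambda>z. r' z * (z i - m' i z)) = 0"
    and m3: "\<And>i. i < k \<Longrightarrow> cube_avg k (\<lambda>z. r' z * (z i - m' i z)\<^sup>2) \<le> cube_avg k r'"
    and m4: "\<And>i j. i < k \<Longrightarrow> j < i \<Longrightarrow> cube_avg k (\<lambda>z. r' z * ((z i - m' i z) * (z j - m' j z))) = 0"
    using Suc.IH[of r'] by auto
  \<comment> \<open>\<open>M\<close> is the conditional mean of the last sign, with value 0 where
    both slices vanish. Resetting coordinate \<open>k\<close> to 0 in \<open>m\<close> makes all
    conditional means independent of the last sign.\<close>
  define M where "M z = (p z - q z) / (p z + q z)" for z
  define m where "m i z = (if i = k then M (z(k := 0)) else m' i (z(k := 0)))" for i z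
  have upd: "z(k := 0) = z" if "z \<in> sign_cube k" for z
    using that by (auto simp: sign_cube_def)
  have M: "M z * (p z + q z) = p z - q z" if "z \<in> sign_cube k" for z
    using pq[OF that] by (cases "p z + q z = 0") (auto simp: M_def)
  have avg: "cube_avg (Suc k) (\<lambda>z. r z * f z)
      = cube_avg k (\<lambda>z. (p z * f (z(k := 1)) + q z * f (z(k := - 1))) / 2)" for f
    by (simp add: cube_avg_Suc p_def q_def)
  have avg_r: "cube_avg (Suc k) r = cube_avg k r'"
    unfolding cube_avg_Suc by (intro cube_avg_cong) (simp add: p_def q_def r'_def)
  \<comment> \<open>Functions that do not depend on the last sign are integrated against the
    marginal density.\<close>
  have avg_lt: "cube_avg (Suc k) (\<lambda>z. r z * f z) = cube_avg k (\<lambda>z. r' z * f' z)"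
    if "\<And>z s. z \<in> sign_cube k \<Longrightarrow> f (z(k := s)) = f' z" for f f'
    unfolding avg by (intro cube_avg_cong) (simp add: that r'_def field_simps)
  show ?case
  proof (intro exI[of _ m] conjI allI impI)
    \<comment> \<open>Chain rule: the entropy of \<open>r\<close> exceeds that of \<open>r'\<close>
      by the conditional entropy of the last sign, which \<open>xlnx_midpoint\<close> bounds from
      below slice by slice.\<close>
    have "cube_avg (Suc k) (\<lambda>z. r z * (m k z)\<^sup>2) = cube_avg k (\<lambda>z. r' z * (M z)\<^sup>2)"
      by (rule avg_lt) (simp add: m_def upd)
    also have "\<dots> \<le> cube_avg k (\<lambda>z. (xlnx (p z) + xlnx (q z)) - 2 * xlnx (r' z))"
      unfolding r'_def M_def using xlnx_midpoint pq by (intro cube_avg_mono) auto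
    also have "\<dots> = 2 * cube_avg (Suc k) (\<lambda>z. xlnx (r z)) - 2 * cube_avg k (\<lambda>z. xlnx (r' z))"
      by (simp only: cube_avg_Suc p_def q_def cube_avg_diff cube_avg_mult_left[symmetric])
        (simp add: add_divide_distrib)
    finally have "cube_avg (Suc k) (\<lambda>z. r z * (m k z)\<^sup>2)
      \<le> 2 * cube_avg (Suc k) (\<lambda>z. xlnx (r z)) - 2 * cube_avg k (\<lambda>z. xlnx (r' z))" .
    moreover have "cube_avg (Suc k) (\<lambda>z. r z * (m i z)\<^sup>2) = cube_avg k (\<lambda>z. r' z * (m' i z)\<^sup>2)" if "i < k" for i
      using that by (intro avg_lt) (simp add: m_def upd)
    ultimately show "(\<Sum>i<Suc k. cube_avg (Suc k) (\<lambda>z. r z * (m i z)\<^sup>2))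
      \<le> 2 * (cube_avg (Suc k) (\<lambda>z. xlnx (r z)) - xlnx (cube_avg (Suc k) r))"
      using m1 by (simp add: avg_r)
  next
    fix i assume "i < Suc k"
    show "cube_avg (Suc k) (\<lambda>z. r z * (z i - m i z)) = 0"
    proof (cases "i = k")
      case True
      have "cube_avg (Suc k) (\<lambda>z. r z * (z i - m i z)) = cube_avg k (\<lambda>z. 0)"
        unfolding avg True using M by (intro cube_avg_cong) (auto simp: m_def upd algebra_simps)
      then show ?thesis by simp
    next
      case False
      have "cube_avg (Suc k) (\<lambda>z. r z * (z i - m i z)) = cube_avg k (\<lambda>z. r' z * (z i - m' i z))"
        using False by (intro avg_lt) (simp add: m_def upd)
      then show ?thesis using m2[of i] False \<open>i < Suc k\<close> by simp
    qed
  next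
    fix i assume "i < Suc k"
    show "cube_avg (Suc k) (\<lambda>z. r z * (z i - m i z)\<^sup>2) \<le> cube_avg (Suc k) r"
    proof (cases "i = k")
      case True
      have "(p z * (1 - M z)\<^sup>2 + q z * (- 1 - M z)\<^sup>2) / 2 \<le> r' z" if z: "z \<in> sign_cube k" for z
      proof -
        have "(p z * (1 - M z)\<^sup>2 + q z * (- 1 - M z)\<^sup>2)
            = (p z + q z) + (M z)\<^sup>2 * (p z + q z) - 2 * M z * (p z - q z)"
          by (simp add: power2_eq_square algebra_simps)
        also have "\<dots> = (p z + q z) - (M z)\<^sup>2 * (p z + q z)"
          by (simp add: M[OF z, symmetric] power2_eq_square)
        also have "\<dots> \<le> p z + q z" using pq[OF z] by simp
        finally show ?thesis by (simp add: r'_def)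
      qed
      then show ?thesis
        unfolding avg True avg_r by (intro cube_avg_mono) (simp add: m_def upd)
    next
      case False
      have "cube_avg (Suc k) (\<lambda>z. r z * (z i - m i z)\<^sup>2) = cube_avg k (\<lambda>z. r' z * (z i - m' i z)\<^sup>2)"
        using False by (intro avg_lt) (simp add: m_def upd)
      then show ?thesis using m3[of i] False \<open>i < Suc k\<close> by (simp add: avg_r)
    qed
  next
    fix i j assume "i < Suc k" "j < i"
    show "cube_avg (Suc k) (\<lambda>z. r z * ((z i - m i z) * (z j - m j z))) = 0"
    proof (cases "i = k")
      case True
      \<comment> \<open>The last martingale difference has conditional mean zero, so it is
        orthogonal to any factor \<open>c\<close> determined by the earlier signs.\<close>
      have "p z * ((1 - M z) * c) + q z * ((- 1 - M z) * c) = 0" if "z \<in> sign_cube k" for z c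
      proof -
        have "p z * ((1 - M z) * c) + q z * ((- 1 - M z) * c) = ((p z - q z) - M z * (p z + q z)) * c"
          by (simp add: algebra_simps)
        then show ?thesis using M[OF that] by simp
      qed
      then have "cube_avg (Suc k) (\<lambda>z. r z * ((z i - m i z) * (z j - m j z))) = cube_avg k (\<lambda>z. 0)"
        unfolding avg True using \<open>j < i\<close> True by (intro cube_avg_cong) (simp add: m_def upd)
      then show ?thesis by simp
    next
      case False
      have "cube_avg (Suc k) (\<lambda>z. r z * ((z i - m i z) * (z j - m j z)))
          = cube_avg k (\<lambda>z. r' z * ((z i - m' i z) * (z j - m' j z)))"
        using False \<open>j < i\<close> \<open>i < Suc k\<close> by (intro avg_lt) (simp add: m_def upd)
      then show ?thesis using m4[of i j] False \<open>j < i\<close> \<open>i < Suc k\<close> by simp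
    qed
  qed
qed

text \<open>Expands the nonnegative weighted second moment of \<open>f\<close> about its weighted
  mean \<open>S / R\<close>; if the weight has total mass 0, it vanishes pointwise.\<close>

lemma cube_avg_cauchy_schwarz:
  assumes "\<And>z. z \<in> sign_cube k \<Longrightarrow> 0 \<le> r z"
  shows "(cube_avg k (\<lambda>z. r z * f z))\<^sup>2 \<le> cube_avg k r * cube_avg k (\<lambda>z. r z * (f z)\<^sup>2)"
proof (cases "cube_avg k r = 0")
  case True
  have "r z = 0" if "z \<in> sign_cube k" for z
    using True assms that by (simp add: cube_avg_def sum_nonneg_eq_0_iff)
  then have "cube_avg k (\<lambda>z. r z * f z) = cube_avg k (\<lambda>z. 0)"
    by (intro cube_avg_cong) simp
  then show ?thesis using True by simp
next
  case False
  define R S where "R = cube_avg k r" and "S = cube_avg k (\<lambda>z. r z * f z)"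
  have R: "R > 0"
    using False cube_avg_nonneg[of k r] assms by (simp add: R_def order_less_le)
  have "0 \<le> cube_avg k (\<lambda>z. r z * (f z - S / R)\<^sup>2)"
    using assms by (intro cube_avg_nonneg) simp
  also have "(\<lambda>z. r z * (f z - S / R)\<^sup>2)
      = (\<lambda>z. r z * (f z)\<^sup>2 - (2 * S / R) * (r z * f z) + (S / R)\<^sup>2 * r z)"
    by (auto simp: power2_eq_square algebra_simps)
  also have "cube_avg k \<dots> = cube_avg k (\<lambda>z. r z * (f z)\<^sup>2) - S\<^sup>2 / R"
    unfolding cube_avg_add cube_avg_diff cube_avg_mult_left R_def[symmetric] S_def[symmetric]
    using R by (simp add: power2_eq_square field_simps)
  finally show ?thesis
    using R unfolding R_def[symmetric] S_def[symmetric] by (simp add: field_simps)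
qed

text \<open>The differences \<open>z i - m i z\<close> average to zero, so the mean of each sign is
  that of \<open>m i\<close>, and Cauchy-Schwarz passes to the squares controlled by the entropy.
  The density is left unnormalized, whence the factor \<open>cube_avg k r\<close>.\<close>

lemma sign_cube_first_moment_entropy:
  assumes "\<And>z. z \<in> sign_cube k \<Longrightarrow> 0 \<le> r z"
  shows "(\<Sum>i<k. (cube_avg k (\<lambda>z. r z * z i))\<^sup>2)
    \<le> 2 * cube_avg k r * (cube_avg k (\<lambda>z. xlnx (r z)) - xlnx (cube_avg k r))"
proof -
  obtain m where m:
    "(\<Sum>i<k. cube_avg k (\<lambda>z. r z * (m i z)\<^sup>2)) \<le> 2 * (cube_avg k (\<lambda>z. xlnx (r z)) - xlnx (cube_avg k r))"
    "\<And>i. i < k \<Longrightarrow> cube_avg k (\<lambda>z. r z * (z i - m i z)) = 0"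
    using sign_cube_martingale[of k r] assms by auto
  have "cube_avg k (\<lambda>z. r z * z i) = cube_avg k (\<lambda>z. r z * m i z)" if "i < k" for i
    using m(2)[OF that] by (simp add: right_diff_distrib cube_avg_diff)
  then have "(\<Sum>i<k. (cube_avg k (\<lambda>z. r z * z i))\<^sup>2)
      \<le> (\<Sum>i<k. cube_avg k r * cube_avg k (\<lambda>z. r z * (m i z)\<^sup>2))"
    using cube_avg_cauchy_schwarz[OF assms] by (intro sum_mono) auto
  also have "\<dots> = cube_avg k r * (\<Sum>i<k. cube_avg k (\<lambda>z. r z * (m i z)\<^sup>2))"
    by (simp add: sum_distrib_left)
  also have "\<dots> \<le> cube_avg k r * (2 * (cube_avg k (\<lambda>z. xlnx (r z)) - xlnx (cube_avg k r)))"
    using assms by (intro mult_left_mono m(1) cube_avg_nonneg)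
  finally show ?thesis by (simp add: algebra_simps)
qed

definition quad_form :: "nat \<Rightarrow> (nat \<Rightarrow> nat \<Rightarrow> real) \<Rightarrow> (nat \<Rightarrow> real) \<Rightarrow> real" where
  "quad_form k h v = (\<Sum>i<k. \<Sum>j<k. v i * v j * h i j)"

lemma quad_form_unit: "i < k \<Longrightarrow> quad_form k h (\<lambda>j. if j = i then 1 else 0) = h i i"
proof -
  assume i: "i < k"
  have "quad_form k h (\<lambda>j. if j = i then 1 else 0) = (\<Sum>a<k. \<Sum>b<k. if b = i then (if a = i then h i i else 0) else 0)"
    unfolding quad_form_def by (intro sum.cong refl) simp
  then show ?thesis using i by simp
qed

text \<open>Split \<open>z\<close> into the martingale differences, which are orthogonal and contribute the trace,
  and the conditional means, whose squared length is controlled by the entropy.\<close>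

lemma sign_cube_quad_form_entropy:
  assumes r: "\<And>z. z \<in> sign_cube k \<Longrightarrow> 0 \<le> r z"
    and psd: "\<And>v. 0 \<le> quad_form k h v"
    and op: "\<And>v. quad_form k h v \<le> b * (\<Sum>i<k. (v i)\<^sup>2)"
    and b: "0 \<le> b"
  shows "cube_avg k (\<lambda>z. r z * quad_form k h z)
    \<le> 2 * (\<Sum>i<k. h i i) * cube_avg k r
      + 4 * b * (cube_avg k (\<lambda>z. xlnx (r z)) - xlnx (cube_avg k r))"
proof -
  obtain m where m1:
    "(\<Sum>i<k. cube_avg k (\<lambda>z. r z * (m i z)\<^sup>2)) \<le> 2 * (cube_avg k (\<lambda>z. xlnx (r z)) - xlnx (cube_avg k r))"
    and m3: "\<And>i. i < k \<Longrightarrow> cube_avg k (\<lambda>z. r z * (z i - m i z)\<^sup>2) \<le> cube_avg k r"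
    and m4: "\<And>i j. i < k \<Longrightarrow> j < i \<Longrightarrow> cube_avg k (\<lambda>z. r z * ((z i - m i z) * (z j - m j z))) = 0"
    using sign_cube_martingale[of k r] r by auto
  have diag: "0 \<le> h i i" if "i < k" for i
    using psd[of "\<lambda>j. if j = i then 1 else 0"] that by (simp add: quad_form_unit)
  define \<xi> where "\<xi> z i = z i - m i z" for z i
  define \<mu> where "\<mu> z i = m i z" for z i
  have orth: "cube_avg k (\<lambda>z. r z * (\<xi> z i * \<xi> z j)) = 0" if "i < k" "j < k" "i \<noteq> j" for i j
    using m4[of i j] m4[of j i] that by (cases i j rule: linorder_cases) (auto simp: \<xi>_def mult.commute)
  \<comment> \<open>Orthogonality kills all off-diagonal terms of the martingale part, and each
    diagonal one is at most \<open>h i i\<close> times the total mass.\<close>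
  have "cube_avg k (\<lambda>z. r z * quad_form k h (\<xi> z))
      = (\<Sum>i<k. \<Sum>j<k. h i j * cube_avg k (\<lambda>z. r z * (\<xi> z i * \<xi> z j)))"
    unfolding quad_form_def
    by (simp add: sum_distrib_left cube_avg_sum cube_avg_mult_left[symmetric] mult_ac)
  also have "\<dots> = (\<Sum>i<k. \<Sum>j<k. if j = i then h i i * cube_avg k (\<lambda>z. r z * (\<xi> z i * \<xi> z i)) else 0)"
    by (intro sum.cong refl) (auto simp: orth)
  also have "\<dots> = (\<Sum>i<k. h i i * cube_avg k (\<lambda>z. r z * (\<xi> z i)\<^sup>2))"
    by (simp add: power2_eq_square)
  also have "\<dots> \<le> (\<Sum>i<k. h i i * cube_avg k r)"
    using m3 diag by (intro sum_mono mult_left_mono) (auto simp: \<xi>_def)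
  finally have 1: "cube_avg k (\<lambda>z. r z * quad_form k h (\<xi> z)) \<le> (\<Sum>i<k. h i i) * cube_avg k r"
    by (simp add: sum_distrib_right)
  have "cube_avg k (\<lambda>z. r z * quad_form k h (\<mu> z)) \<le> cube_avg k (\<lambda>z. r z * (b * (\<Sum>i<k. (\<mu> z i)\<^sup>2)))"
    using r op by (intro cube_avg_mono mult_left_mono) auto
  also have "\<dots> = b * (\<Sum>i<k. cube_avg k (\<lambda>z. r z * (m i z)\<^sup>2))"
    unfolding \<mu>_def
    by (simp add: cube_avg_mult_left[symmetric] cube_avg_sum[symmetric] sum_distrib_left mult_ac)
  also have "\<dots> \<le> b * (2 * (cube_avg k (\<lambda>z. xlnx (r z)) - xlnx (cube_avg k r)))"
    using b m1 by (rule mult_left_mono[rotated])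
  finally have 2: "cube_avg k (\<lambda>z. r z * quad_form k h (\<mu> z))
    \<le> b * (2 * (cube_avg k (\<lambda>z. xlnx (r z)) - xlnx (cube_avg k r)))" .
  \<comment> \<open>Parallelogram identity for \<open>z = \<xi> + \<mu>\<close>: the gap is the form
    at \<open>\<xi> - \<mu>\<close>, which is nonnegative.\<close>
  have "quad_form k h z \<le> 2 * quad_form k h (\<xi> z) + 2 * quad_form k h (\<mu> z)" for z
  proof -
    have "2 * quad_form k h (\<xi> z) + 2 * quad_form k h (\<mu> z) - quad_form k h z
        = quad_form k h (\<lambda>i. \<xi> z i - \<mu> z i)"
      unfolding quad_form_def sum_distrib_left sum.distrib[symmetric] sum_subtractf[symmetric]
      by (intro sum.cong refl) (simp add: \<xi>_def \<mu>_def algebra_simps)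
    then show ?thesis using psd[of "\<lambda>i. \<xi> z i - \<mu> z i"] by linarith
  qed
  then have "cube_avg k (\<lambda>z. r z * quad_form k h z)
      \<le> cube_avg k (\<lambda>z. r z * (2 * quad_form k h (\<xi> z) + 2 * quad_form k h (\<mu> z)))"
    using r by (intro cube_avg_mono mult_left_mono) auto
  also have "\<dots> = 2 * cube_avg k (\<lambda>z. r z * quad_form k h (\<xi> z)) + 2 * cube_avg k (\<lambda>z. r z * quad_form k h (\<mu> z))"
    by (simp add: cube_avg_add[symmetric] cube_avg_mult_left[symmetric] algebra_simps)
  finally show ?thesis using 1 2 by linarith
qed

section \<open>Expectations of bounded functions\<close>

lemma integrable_pmf_bounded:
  fixes f :: "'a \<Rightarrow> real"
  assumes "\<And>x. x \<in> set_pmf p \<Longrightarrow> \<bar>f x\<bar> \<le> B"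
  shows "integrable (measure_pmf p) f"
  using assms by (intro measure_pmf.integrable_const_bound[where B = B]) (auto simp: AE_measure_pmf_iff)

lemma expectation_mono:
  fixes f g :: "'a \<Rightarrow> real"
  assumes "integrable (measure_pmf p) f" "integrable (measure_pmf p) g"
    and "\<And>x. x \<in> set_pmf p \<Longrightarrow> f x \<le> g x"
  shows "measure_pmf.expectation p f \<le> measure_pmf.expectation p g"
  using assms by (intro integral_mono_AE) (auto simp: AE_measure_pmf_iff)

lemma expectation_bind_nonneg:
  fixes f :: "'b \<Rightarrow> real"
  assumes "\<And>y. 0 \<le> f y" "\<And>y. f y \<le> B"
  shows "measure_pmf.expectation (bind_pmf p g) f
    = measure_pmf.expectation p (\<lambda>x. measure_pmf.expectation (g x) f)"
proof -
  have int: "integrable (measure_pmf q) f" for q :: "'b pmf"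
    using assms by (intro integrable_pmf_bounded[of _ _ B]) auto
  have "measure_pmf.expectation q f \<le> B" for q :: "'b pmf"
    using measure_pmf.integral_le_const[OF int, of B q] assms by simp
  then have int2: "integrable (measure_pmf p) (\<lambda>x. measure_pmf.expectation (g x) f)"
    using assms by (intro integrable_pmf_bounded[of _ _ B]) (auto intro!: Bochner_Integration.integral_nonneg)
  have "ennreal (measure_pmf.expectation (bind_pmf p g) f) = (\<integral>\<^sup>+y. ennreal (f y) \<partial>bind_pmf p g)"
    using assms by (intro nn_integral_eq_integral[symmetric] int) auto
  also have "\<dots> = (\<integral>\<^sup>+x. \<integral>\<^sup>+y. ennreal (f y) \<partial>g x \<partial>p)"
    by simp
  also have "\<dots> = (\<integral>\<^sup>+x. ennreal (measure_pmf.expectation (g x) f) \<partial>p)"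
    using assms by (subst nn_integral_eq_integral[OF int]) auto
  also have "\<dots> = ennreal (measure_pmf.expectation p (\<lambda>x. measure_pmf.expectation (g x) f))"
    using assms by (intro nn_integral_eq_integral int2) (auto intro!: Bochner_Integration.integral_nonneg)
  finally show ?thesis
    using assms by (subst (asm) ennreal_inj) (auto intro!: Bochner_Integration.integral_nonneg)
qed

text \<open>Reduced to the nonnegative case by adding \<open>B\<close>.\<close>

lemma expectation_bind_bounded:
  fixes f :: "'b \<Rightarrow> real"
  assumes "\<And>y. y \<in> set_pmf (bind_pmf p g) \<Longrightarrow> \<bar>f y\<bar> \<le> B"
  shows "measure_pmf.expectation (bind_pmf p g) f
    = measure_pmf.expectation p (\<lambda>x. measure_pmf.expectation (g x) f)"
proof -
  \<comment> \<open>The bound is known only on the support, so the shifted function is set to 0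
    elsewhere.\<close>
  define f' where "f' y = (if y \<in> set_pmf (bind_pmf p g) then f y + B else 0)" for y
  have int: "integrable (measure_pmf (bind_pmf p g)) f"
    using assms by (intro integrable_pmf_bounded[of _ _ B]) auto
  have int': "integrable (measure_pmf (g x)) f" if "x \<in> set_pmf p" for x
    using assms that by (intro integrable_pmf_bounded[of _ _ B]) auto
  have f': "0 \<le> f' y" "f' y \<le> 2 * \<bar>B\<bar>" for y
    using assms[of y] by (auto simp: f'_def abs_le_iff simp del: set_bind_pmf)
  have "measure_pmf.expectation (bind_pmf p g) f + B
      = measure_pmf.expectation (bind_pmf p g) (\<lambda>y. f y + B)"
    using int by simp
  also have "\<dots> = measure_pmf.expectation (bind_pmf p g) f'"
    by (intro integral_cong_AE) (auto simp: AE_measure_pmf_iff f'_def)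
  also have "\<dots> = measure_pmf.expectation p (\<lambda>x. measure_pmf.expectation (g x) f')"
    by (rule expectation_bind_nonneg[OF f'])
  also have "\<dots> = measure_pmf.expectation p (\<lambda>x. measure_pmf.expectation (g x) f + B)"
  proof (intro integral_cong_AE)
    have "measure_pmf.expectation (g x) f' = measure_pmf.expectation (g x) f + B" if x: "x \<in> set_pmf p" for x
    proof -
      have "measure_pmf.expectation (g x) f' = measure_pmf.expectation (g x) (\<lambda>y. f y + B)"
        using x by (intro integral_cong_AE) (auto simp: AE_measure_pmf_iff f'_def)
      then show ?thesis using int'[OF x] by simp
    qed
    then show "AE x in measure_pmf p. measure_pmf.expectation (g x) f' = measure_pmf.expectation (g x) f + B"
      by (simp add: AE_measure_pmf_iff)
  qed auto
  also have "\<dots> = measure_pmf.expectation p (\<lambda>x. measure_pmf.expectation (g x) f) + B"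
  proof -
    have "\<bar>measure_pmf.expectation (g x) f\<bar> \<le> B" if x: "x \<in> set_pmf p" for x
    proof -
      have "\<bar>measure_pmf.expectation (g x) f\<bar> \<le> measure_pmf.expectation (g x) (\<lambda>y. \<bar>f y\<bar>)"
        by (rule integral_abs_bound)
      also have "\<dots> \<le> B"
        using assms x int'[OF x]
        by (intro measure_pmf.integral_le_const) (auto simp: AE_measure_pmf_iff)
      finally show ?thesis .
    qed
    then have "integrable (measure_pmf p) (\<lambda>x. measure_pmf.expectation (g x) f)"
      by (intro integrable_pmf_bounded[of _ _ B]) auto
    then show ?thesis by simp
  qed
  finally show ?thesis by simp
qed

lemma expectation_cube_avg:
  assumes "\<And>z. z \<in> sign_cube k \<Longrightarrow> integrable (measure_pmf p) (f z)"
  shows "measure_pmf.expectation p (\<lambda>x. cube_avg k (\<lambda>z. f z x))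
    = cube_avg k (\<lambda>z. measure_pmf.expectation p (f z))"
  using assms by (simp add: cube_avg_def Bochner_Integration.integral_sum)

text \<open>The one-round increment of a divergence. Taking expectations in
  \<open>xlnx_le_quadratic\<close> removes the linear term, as the increment \<open>N\<close> has
  mean zero. At \<open>r = 0\<close> the quotient is 0 and \<open>N\<close> vanishes.\<close>

lemma expectation_xlnx_step:
  fixes N :: "'a \<Rightarrow> real"
  assumes r: "0 \<le> r" and r0: "\<And>y. r = 0 \<Longrightarrow> N y = 0"
    and nonneg: "\<And>y. 0 \<le> r + N y" and bound: "\<And>y. \<bar>N y\<bar> \<le> B"
    and mean: "measure_pmf.expectation p N = 0"
  shows "measure_pmf.expectation p (\<lambda>y. xlnx (r + N y))
    \<le> xlnx r + measure_pmf.expectation p (\<lambda>y. (N y)\<^sup>2) / r"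
proof (cases "r = 0")
  case True
  then show ?thesis using r0 by simp
next
  case False
  then have r: "r > 0" using r by simp
  have iN: "integrable (measure_pmf p) N"
    using bound by (intro integrable_pmf_bounded[of _ _ B])
  have "\<bar>(N y)\<^sup>2\<bar> \<le> B\<^sup>2" for y
    using power_mono[OF bound[of y], of 2] by simp
  then have iN2: "integrable (measure_pmf p) (\<lambda>y. (N y)\<^sup>2)"
    by (intro integrable_pmf_bounded[of _ _ "B\<^sup>2"])
  have "r + N y \<le> r + B" for y using bound[of y] by linarith
  then have "integrable (measure_pmf p) (\<lambda>y. xlnx (r + N y))"
    using abs_xlnx_le nonneg by (intro integrable_pmf_bounded[of _ _ "(r + B)\<^sup>2 + 1"]) blast
  then have "measure_pmf.expectation p (\<lambda>y. xlnx (r + N y))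
      \<le> measure_pmf.expectation p (\<lambda>y. xlnx r + (ln r + 1) * N y + (N y)\<^sup>2 / r)"
    using xlnx_le_quadratic[OF r nonneg] iN iN2 by (intro expectation_mono) auto
  also have "\<dots> = xlnx r + measure_pmf.expectation p (\<lambda>y. (N y)\<^sup>2) / r"
    using iN iN2 by (simp add: mean)
  finally show ?thesis .
qed

section \<open>The channel information matrix\<close>

lemma sum_pairs:
  fixes g :: "nat \<Rightarrow> real"
  shows "(\<Sum>x = 1..2 * k. g x) = (\<Sum>i<k. g (2 * i + 1) + g (2 * i + 2))"
  by (induction k) simp_all

definition out_mass :: "nat \<Rightarrow> 'y channel \<Rightarrow> 'y \<Rightarrow> real" where
  "out_mass k W y = (\<Sum>x = 1..2 * k. pmf (W x) y)"

text \<open>Up to the factor \<open>1 / (2 * k)\<close>, this is the difference of the output laws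
  of a symbol pair, as a density with respect to the output law under uniform input. It is 0 where
  \<open>out_mass\<close> vanishes.\<close>

definition pair_bias :: "nat \<Rightarrow> 'y channel \<Rightarrow> nat \<Rightarrow> 'y \<Rightarrow> real" where
  "pair_bias k W i y = (pmf (W (2 * i + 1)) y - pmf (W (2 * i + 2)) y) / out_mass k W y"

lemma out_mass_nonneg: "0 \<le> out_mass k W y"
  by (simp add: out_mass_def sum_nonneg)

lemma pair_bias_mult_out_mass:
  assumes "i < k"
  shows "pair_bias k W i y * out_mass k W y = pmf (W (2 * i + 1)) y - pmf (W (2 * i + 2)) y"
proof (cases "out_mass k W y = 0")
  case True
  then have "pmf (W x) y = 0" if "x \<in> {1..2 * k}" for x
    using that by (simp add: out_mass_def sum_nonneg_eq_0_iff)
  from this[of "2 * i + 1"] this[of "2 * i + 2"] assms show ?thesis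
    by (simp add: True)
qed (simp add: pair_bias_def)

text \<open>Each absolute difference is at most the sum of its two terms, and those sums add up to
  \<open>out_mass\<close>. This bound keeps one-round likelihood factors between 0 and 2 and the
  trace at most \<open>2 * k\<close>.\<close>

lemma sum_abs_pair_bias_le: "(\<Sum>i<k. \<bar>pair_bias k W i y\<bar>) \<le> 1"
proof -
  have "(\<Sum>i<k. \<bar>pair_bias k W i y\<bar>)
      = (\<Sum>i<k. \<bar>pmf (W (2 * i + 1)) y - pmf (W (2 * i + 2)) y\<bar>) / out_mass k W y"
    using out_mass_nonneg[of k W y] by (simp add: pair_bias_def sum_divide_distrib)
  also have "\<dots> \<le> (\<Sum>i<k. pmf (W (2 * i + 1)) y + pmf (W (2 * i + 2)) y) / out_mass k W y"
    by (intro divide_right_mono sum_mono out_mass_nonneg) (auto simp: abs_le_iff)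
  also have "\<dots> = out_mass k W y / out_mass k W y"
    by (simp only: sum_pairs out_mass_def)
  also have "\<dots> \<le> 1" by simp
  finally show ?thesis .
qed

lemma abs_pair_bias_le: "i < k \<Longrightarrow> \<bar>pair_bias k W i y\<bar> \<le> 1"
  using member_le_sum[of i "{..<k}" "\<lambda>i. \<bar>pair_bias k W i y\<bar>"] sum_abs_pair_bias_le[of k W y] by simp

lemma abs_pair_bias_mult_le:
  "i < k \<Longrightarrow> j < k \<Longrightarrow> \<bar>pair_bias k W i y * pair_bias k W j y\<bar> \<le> 1"
  unfolding abs_mult by (intro mult_le_one abs_pair_bias_le) auto

lemma abs_sum_pair_bias_le:
  assumes "\<And>i. i < k \<Longrightarrow> \<bar>v i\<bar> \<le> B" "0 \<le> B"
  shows "\<bar>\<Sum>i<k. v i * pair_bias k W i y\<bar> \<le> B"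
proof -
  have "\<bar>\<Sum>i<k. v i * pair_bias k W i y\<bar> \<le> (\<Sum>i<k. \<bar>v i * pair_bias k W i y\<bar>)"
    by (rule sum_abs)
  also have "\<dots> \<le> (\<Sum>i<k. B * \<bar>pair_bias k W i y\<bar>)"
    using assms by (intro sum_mono) (auto simp: abs_mult intro!: mult_right_mono)
  also have "\<dots> \<le> B"
    using mult_left_mono[OF sum_abs_pair_bias_le[of k W y] assms(2)] by (simp add: sum_distrib_left)
  finally show ?thesis .
qed

definition unif_out :: "nat \<Rightarrow> 'y channel \<Rightarrow> 'y pmf" where
  "unif_out k W = bind_pmf (pmf_of_set {1..2 * k}) W"

lemma pmf_unif_out: "k \<ge> 1 \<Longrightarrow> pmf (unif_out k W) y = out_mass k W y / (2 * real k)"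
  unfolding unif_out_def by (subst pmf_bind_pmf_of_set) (auto simp: out_mass_def)

lemma integrable_pair_bias: "i < k \<Longrightarrow> integrable (measure_pmf p) (pair_bias k W i)"
  using abs_pair_bias_le by (intro integrable_pmf_bounded[of _ _ 1])

text \<open>Weighted by the output law, the bias is a multiple of the difference of two probability
  mass functions, both of total mass 1.\<close>

lemma expectation_pair_bias:
  assumes "k \<ge> 1" "i < k"
  shows "measure_pmf.expectation (unif_out k W) (pair_bias k W i) = 0"
proof -
  have "pmf (unif_out k W) y * pair_bias k W i y
      = (1 / (2 * real k)) * (pmf (W (2 * i + 1)) y - pmf (W (2 * i + 2)) y)" for y
    using pair_bias_mult_out_mass[OF assms(2), of W y] by (simp add: pmf_unif_out[OF assms(1)] mult_ac)
  then have "measure_pmf.expectation (unif_out k W) (pair_bias k W i)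
      = infsetsum (\<lambda>y. (1 / (2 * real k)) * (pmf (W (2 * i + 1)) y - pmf (W (2 * i + 2)) y)) UNIV"
    by (simp add: pmf_expectation_eq_infsetsum)
  also have "\<dots> = (1 / (2 * real k)) * (infsetsum (pmf (W (2 * i + 1))) UNIV - infsetsum (pmf (W (2 * i + 2))) UNIV)"
    by (subst infsetsum_cmult_right, (intro abs_summable_on_diff pmf_abs_summable)[1])
      (subst infsetsum_diff, auto)
  also have "\<dots> = 0" by (simp add: infsetsum_pmf_eq_1)
  finally show ?thesis .
qed

lemma expectation_sum_pair_bias:
  assumes "k \<ge> 1"
  shows "measure_pmf.expectation (unif_out k W) (\<lambda>y. \<Sum>i<k. v i * pair_bias k W i y) = 0"
  using assms by (subst Bochner_Integration.integral_sum) (auto simp: integrable_pair_bias expectation_pair_bias)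

section \<open>The information matrix as a second moment matrix\<close>

lemma channel_info_matrix_carrier: "channel_info_matrix k W \<in> carrier_mat k k"
  by (simp add: channel_info_matrix_def)

lemma channel_info_matrix_eq:
  assumes "k \<ge> 1" "i < k" "j < k"
  shows "channel_info_matrix k W $$ (i, j)
    = 2 * real k * measure_pmf.expectation (unif_out k W) (\<lambda>y. pair_bias k W i y * pair_bias k W j y)"
proof -
  \<comment> \<open>Products of biases are at most 1 in absolute value, so the terms are dominated
    by a probability mass function; absolute summability then identifies the two notions of infinite
    sum.\<close>
  let ?t = "\<lambda>y. pmf (unif_out k W) y * (pair_bias k W i y * pair_bias k W j y)"
  have "norm (?t y) \<le> norm (pmf (unif_out k W) y)" for y
    using mult_left_mono[OF abs_pair_bias_mult_le[OF assms(2,3), of W y], of "pmf (unif_out k W) y"]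
    by (simp add: abs_mult)
  then have "Infinite_Set_Sum.abs_summable_on ?t UNIV"
    by (intro Infinite_Set_Sum.abs_summable_on_comparison_test[OF pmf_abs_summable]) auto
  then have "measure_pmf.expectation (unif_out k W) (\<lambda>y. pair_bias k W i y * pair_bias k W j y) = infsum ?t UNIV"
    by (simp add: pmf_expectation_eq_infsetsum infsetsum_infsum)
  then have "2 * real k * measure_pmf.expectation (unif_out k W) (\<lambda>y. pair_bias k W i y * pair_bias k W j y)
      = infsum (\<lambda>y. 2 * real k * ?t y) UNIV"
    by (simp add: infsum_cmult_right' del: infsum_cmult_right)
  also have "\<dots> = infsum (\<lambda>y. (pmf (W (2 * i + 1)) y - pmf (W (2 * i + 2)) y) *
       (pmf (W (2 * j + 1)) y - pmf (W (2 * j + 2)) y) / out_mass k W y) {y. out_mass k W y > 0}"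
  proof (rule infsum_cong_neutral)
    fix y
    have "out_mass k W y = 0" if "\<not> out_mass k W y > 0"
      using that out_mass_nonneg[of k W y] by simp
    then show "2 * real k * ?t y = 0" if "y \<in> UNIV - {y. out_mass k W y > 0}"
      using that by (simp add: pmf_unif_out[OF assms(1)])
    show "2 * real k * ?t y = (pmf (W (2 * i + 1)) y - pmf (W (2 * i + 2)) y) *
       (pmf (W (2 * j + 1)) y - pmf (W (2 * j + 2)) y) / out_mass k W y"
      if "y \<in> UNIV \<inter> {y. out_mass k W y > 0}"
      using that assms by (simp add: pmf_unif_out pair_bias_def field_simps)
  qed simp
  finally show ?thesis
    using assms by (simp add: channel_info_matrix_def out_mass_def)
qed

lemma channel_info_matrix_sym:
  "k \<ge> 1 \<Longrightarrow> i < k \<Longrightarrow> j < k \<Longrightarrow> channel_info_matrix k W $$ (i, j) = channel_info_matrix k W $$ (j, i)"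
  by (simp add: channel_info_matrix_eq mult.commute)

lemma channel_info_matrix_bilinear:
  assumes "k \<ge> 1"
  shows "(\<Sum>i<k. \<Sum>j<k. w i * v j * channel_info_matrix k W $$ (i, j))
    = 2 * real k * measure_pmf.expectation (unif_out k W)
        (\<lambda>y. (\<Sum>i<k. w i * pair_bias k W i y) * (\<Sum>j<k. v j * pair_bias k W j y))"
proof -
  have int: "integrable (measure_pmf (unif_out k W)) (\<lambda>y. pair_bias k W i y * pair_bias k W j y)"
    if "i < k" "j < k" for i j
    using that abs_pair_bias_mult_le by (intro integrable_pmf_bounded[of _ _ 1])
  have "measure_pmf.expectation (unif_out k W)
        (\<lambda>y. (\<Sum>i<k. w i * pair_bias k W i y) * (\<Sum>j<k. v j * pair_bias k W j y))
      = measure_pmf.expectation (unif_out k W)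
        (\<lambda>y. \<Sum>i<k. \<Sum>j<k. (w i * v j) * (pair_bias k W i y * pair_bias k W j y))"
    unfolding sum_product by (simp add: mult_ac)
  also have "\<dots> = (\<Sum>i<k. \<Sum>j<k. (w i * v j) *
      measure_pmf.expectation (unif_out k W) (\<lambda>y. pair_bias k W i y * pair_bias k W j y))"
    using int by (subst Bochner_Integration.integral_sum, force)
      (intro sum.cong refl, subst Bochner_Integration.integral_sum, auto)
  finally show ?thesis
    using assms by (simp add: channel_info_matrix_eq sum_distrib_left mult_ac)
qed

abbreviation info_coeff :: "nat \<Rightarrow> 'y channel \<Rightarrow> nat \<Rightarrow> nat \<Rightarrow> real" where
  "info_coeff k W i j \<equiv> channel_info_matrix k W $$ (i, j)"

lemma quad_form_info:
  assumes "k \<ge> 1"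
  shows "quad_form k (info_coeff k W) v
    = 2 * real k * measure_pmf.expectation (unif_out k W) (\<lambda>y. (\<Sum>i<k. v i * pair_bias k W i y)\<^sup>2)"
  unfolding quad_form_def channel_info_matrix_bilinear[OF assms] by (simp add: power2_eq_square)

lemma quad_form_info_nonneg: "k \<ge> 1 \<Longrightarrow> 0 \<le> quad_form k (info_coeff k W) v"
  by (simp add: quad_form_info)

lemma trace_info_eq:
  assumes "k \<ge> 1"
  shows "(\<Sum>i<k. info_coeff k W i i)
    = 2 * real k * measure_pmf.expectation (unif_out k W) (\<lambda>y. \<Sum>i<k. (pair_bias k W i y)\<^sup>2)"
proof -
  have "integrable (measure_pmf (unif_out k W)) (\<lambda>y. (pair_bias k W i y)\<^sup>2)" if "i < k" for i
    using abs_pair_bias_le[OF that] by (intro integrable_pmf_bounded[of _ _ 1]) (simp add: abs_square_le_1)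
  then show ?thesis
    using assms by (simp add: channel_info_matrix_eq Bochner_Integration.integral_sum
        power2_eq_square sum_distrib_left)
qed

lemma sum_pair_bias_sq_le: "(\<Sum>i<k. (pair_bias k W i y)\<^sup>2) \<le> 1"
proof -
  have "(\<Sum>i<k. (pair_bias k W i y)\<^sup>2) \<le> (\<Sum>i<k. \<bar>pair_bias k W i y\<bar>)"
  proof (intro sum_mono)
    fix i assume "i \<in> {..<k}"
    then have "\<bar>pair_bias k W i y\<bar> * \<bar>pair_bias k W i y\<bar> \<le> 1 * \<bar>pair_bias k W i y\<bar>"
      using abs_pair_bias_le[of i k W y] by (intro mult_right_mono) auto
    then show "(pair_bias k W i y)\<^sup>2 \<le> \<bar>pair_bias k W i y\<bar>"
      by (simp add: power2_eq_square)
  qed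
  then show ?thesis using sum_abs_pair_bias_le[of k W y] by linarith
qed

lemma integrable_sum_pair_bias_sq:
  "integrable (measure_pmf p) (\<lambda>y. \<Sum>i<k. (pair_bias k W i y)\<^sup>2)"
  using sum_pair_bias_sq_le by (intro integrable_pmf_bounded[of _ _ 1]) (simp add: sum_nonneg)

lemma trace_info_bounds:
  assumes "k \<ge> 1"
  shows "0 \<le> (\<Sum>i<k. info_coeff k W i i)" "(\<Sum>i<k. info_coeff k W i i) \<le> 2 * real k"
proof -
  show "0 \<le> (\<Sum>i<k. info_coeff k W i i)"
    unfolding trace_info_eq[OF assms]
    by (intro mult_nonneg_nonneg Bochner_Integration.integral_nonneg sum_nonneg) auto
  have "measure_pmf.expectation (unif_out k W) (\<lambda>y. \<Sum>i<k. (pair_bias k W i y)\<^sup>2) \<le> 1"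
    using sum_pair_bias_sq_le
    by (intro measure_pmf.integral_le_const integrable_sum_pair_bias_sq AE_I2)
  then show "(\<Sum>i<k. info_coeff k W i i) \<le> 2 * real k"
    unfolding trace_info_eq[OF assms] using assms
    by (simp add: mult_left_le)
qed

text \<open>The matrix averages the rank-one matrices of the bias vectors. Cauchy-Schwarz for each
  output \<open>y\<close> leaves the squared length of the bias vector, whose expectation is the
  trace divided by \<open>2 * k\<close>. This is the a priori bound that \<open>op_norm_le\<close>
  asks for.\<close>

lemma info_bilinear_le_trace:
  assumes "k \<ge> 1"
  shows "(\<Sum>i<k. \<Sum>j<k. w i * v j * info_coeff k W i j)
    \<le> (\<Sum>i<k. info_coeff k W i i) * sqrt (\<Sum>i<k. (w i)\<^sup>2) * sqrt (\<Sum>i<k. (v i)\<^sup>2)"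
proof -
  define b where "b y i = pair_bias k W i y" for y i
  have cs: "\<bar>\<Sum>i<k. x i * b y i\<bar> \<le> L2_set x {..<k} * L2_set (b y) {..<k}" for x y
  proof -
    have "\<bar>\<Sum>i<k. x i * b y i\<bar> \<le> (\<Sum>i<k. \<bar>x i\<bar> * \<bar>b y i\<bar>)"
      using sum_abs[of "\<lambda>i. x i * b y i"] by (simp add: abs_mult)
    also have "\<dots> \<le> L2_set x {..<k} * L2_set (b y) {..<k}"
      by (rule L2_set_mult_ineq)
    finally show ?thesis .
  qed
  have pt: "(\<Sum>i<k. w i * b y i) * (\<Sum>j<k. v j * b y j)
      \<le> L2_set w {..<k} * L2_set v {..<k} * (\<Sum>i<k. (b y i)\<^sup>2)" for y
  proof -
    have "(\<Sum>i<k. w i * b y i) * (\<Sum>j<k. v j * b y j)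
        \<le> \<bar>\<Sum>i<k. w i * b y i\<bar> * \<bar>\<Sum>j<k. v j * b y j\<bar>"
      by (simp add: abs_mult[symmetric])
    also have "\<dots> \<le> (L2_set w {..<k} * L2_set (b y) {..<k}) * (L2_set v {..<k} * L2_set (b y) {..<k})"
      by (intro mult_mono cs) (auto simp: L2_set_nonneg)
    also have "\<dots> = L2_set w {..<k} * L2_set v {..<k} * (L2_set (b y) {..<k})\<^sup>2"
      by (simp add: power2_eq_square)
    finally show ?thesis
      by (simp add: L2_set_def sum_nonneg)
  qed
  have "\<bar>\<Sum>i<k. x i * b y i\<bar> \<le> L2_set x {..<k}" for x y
  proof -
    have "L2_set (b y) {..<k} \<le> 1"
      using sum_pair_bias_sq_le[of k W y] by (simp add: L2_set_def b_def)
    then show ?thesis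
      using cs[of x y] mult_left_le[of "L2_set (b y) {..<k}" "L2_set x {..<k}"] L2_set_nonneg[of x "{..<k}"] by linarith
  qed
  then have "\<bar>(\<Sum>i<k. w i * b y i) * (\<Sum>j<k. v j * b y j)\<bar> \<le> L2_set w {..<k} * L2_set v {..<k}" for y
    unfolding abs_mult by (intro mult_mono) (auto simp: L2_set_nonneg)
  then have "integrable (measure_pmf (unif_out k W)) (\<lambda>y. (\<Sum>i<k. w i * b y i) * (\<Sum>j<k. v j * b y j))"
    by (rule integrable_pmf_bounded)
  then have "measure_pmf.expectation (unif_out k W) (\<lambda>y. (\<Sum>i<k. w i * b y i) * (\<Sum>j<k. v j * b y j))
      \<le> measure_pmf.expectation (unif_out k W) (\<lambda>y. L2_set w {..<k} * L2_set v {..<k} * (\<Sum>i<k. (b y i)\<^sup>2))"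
    using pt integrable_sum_pair_bias_sq[of "unif_out k W" k W, folded b_def]
    by (intro expectation_mono) auto
  also have "\<dots> = L2_set w {..<k} * L2_set v {..<k} * measure_pmf.expectation (unif_out k W) (\<lambda>y. \<Sum>i<k. (b y i)\<^sup>2)"
    by simp
  finally have "2 * real k * measure_pmf.expectation (unif_out k W) (\<lambda>y. (\<Sum>i<k. w i * b y i) * (\<Sum>j<k. v j * b y j))
      \<le> 2 * real k * (L2_set w {..<k} * L2_set v {..<k} * measure_pmf.expectation (unif_out k W) (\<lambda>y. \<Sum>i<k. (b y i)\<^sup>2))"
    by (intro mult_left_mono) auto
  then show ?thesis
    unfolding channel_info_matrix_bilinear[OF assms] trace_info_eq[OF assms]
    by (simp add: b_def L2_set_def mult_ac)
qed

lemma op_norm_info: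
  assumes "k \<ge> 1"
  shows "op_norm (channel_info_matrix k W) \<le> (\<Sum>i<k. info_coeff k W i i)"
    and "quad_form k (info_coeff k W) v \<le> op_norm (channel_info_matrix k W) * (\<Sum>i<k. (v i)\<^sup>2)"
  unfolding quad_form_def
  using assms
  by (intro op_norm_le[OF channel_info_matrix_carrier _ trace_info_bounds(1) info_bilinear_le_trace]; simp)+

lemma trace_info_le_nuclear_norm:
  "k \<ge> 1 \<Longrightarrow> (\<Sum>i<k. info_coeff k W i i) \<le> nuclear_norm (channel_info_matrix k W)"
  by (intro trace_le_nuclear_norm channel_info_matrix_carrier channel_info_matrix_sym)

section \<open>Perturbations of the uniform distribution\<close>

text \<open>Symbols \<open>2 * i + 1\<close> and \<open>2 * i + 2\<close> share the index
  \<open>(x - 1) div 2 = i\<close>. Mass moves only within a pair, and the factor 2 brings the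
  distance from uniform up to \<open>\<epsilon>\<close>.\<close>

definition pert_weight :: "nat \<Rightarrow> real \<Rightarrow> (nat \<Rightarrow> real) \<Rightarrow> nat \<Rightarrow> real" where
  "pert_weight k \<epsilon> z x =
    (if x \<in> {1..2 * k}
     then (1 + 2 * \<epsilon> * ((if odd x then 1 else - 1) * z ((x - 1) div 2))) / (2 * real k) else 0)"

definition pert_pmf :: "nat \<Rightarrow> real \<Rightarrow> (nat \<Rightarrow> real) \<Rightarrow> nat pmf" where
  "pert_pmf k \<epsilon> z = embed_pmf (pert_weight k \<epsilon> z)"

lemma pert_weight_pair:
  assumes "i < k"
  shows "pert_weight k \<epsilon> z (2 * i + 1) = (1 + 2 * \<epsilon> * z i) / (2 * real k)"
    and "pert_weight k \<epsilon> z (2 * i + 2) = (1 - 2 * \<epsilon> * z i) / (2 * real k)"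
  using assms by (auto simp: pert_weight_def)

lemma sign_cube_cases: "z \<in> sign_cube k \<Longrightarrow> i < k \<Longrightarrow> z i = 1 \<or> z i = - 1"
  by (simp add: sign_cube_def)

context
  fixes k :: nat and \<epsilon> :: real
  assumes k: "k \<ge> 1" and eps: "0 < \<epsilon>" "\<epsilon> \<le> 1 / 2"
begin

lemma pmf_pert:
  assumes z: "z \<in> sign_cube k"
  shows "pmf (pert_pmf k \<epsilon> z) x = pert_weight k \<epsilon> z x"
proof -
  have nonneg: "0 \<le> pert_weight k \<epsilon> z x" for x
  proof (cases "x \<in> {1..2 * k}")
    case True
    then have "(x - 1) div 2 < k" by auto
    from sign_cube_cases[OF z this] show ?thesis
      using eps by (auto simp: pert_weight_def)
  qed (auto simp: pert_weight_def)
  have "(\<Sum>x = 1..2 * k. pert_weight k \<epsilon> z x) = (\<Sum>i<k. 1 / real k)"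
    unfolding sum_pairs
  proof (intro sum.cong refl)
    fix i assume "i \<in> {..<k}"
    then have "i < k" by simp
    from pert_weight_pair[OF this] show "pert_weight k \<epsilon> z (2 * i + 1) + pert_weight k \<epsilon> z (2 * i + 2) = 1 / real k"
      by (simp only: add_divide_distrib[symmetric]) simp
  qed
  then have sum1: "(\<Sum>x = 1..2 * k. pert_weight k \<epsilon> z x) = 1"
    using k by simp
  have "(\<integral>\<^sup>+x. ennreal (pert_weight k \<epsilon> z x) \<partial>count_space UNIV) = (\<Sum>x = 1..2 * k. ennreal (pert_weight k \<epsilon> z x))"
    by (intro nn_integral_count_space') (auto simp: pert_weight_def)
  also have "\<dots> = 1"
    using nonneg sum1 by (simp only: sum_ennreal ennreal_1)
  finally show ?thesis
    unfolding pert_pmf_def using nonneg by (intro pmf_embed_pmf) auto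
qed

lemma set_pmf_pert: "z \<in> sign_cube k \<Longrightarrow> set_pmf (pert_pmf k \<epsilon> z) \<subseteq> {1..2 * k}"
  by (auto simp: set_pmf_eq pmf_pert pert_weight_def split: if_splits)

text \<open>The one-round likelihood ratio is affine in the signs, with the biases as coefficients;
  everything about the channel enters through them.\<close>

lemma pmf_bind_pert:
  assumes z: "z \<in> sign_cube k"
  shows "pmf (bind_pmf (pert_pmf k \<epsilon> z) W) y
    = pmf (unif_out k W) y * (1 + 2 * \<epsilon> * (\<Sum>i<k. z i * pair_bias k W i y))"
proof -
  have mass: "(\<Sum>i<k. pmf (W (2 * i + 1)) y + pmf (W (2 * i + 2)) y) = out_mass k W y"
    by (simp only: out_mass_def sum_pairs)
  have "pmf (bind_pmf (pert_pmf k \<epsilon> z) W) y = (\<Sum>x = 1..2 * k. pmf (W x) y * pert_weight k \<epsilon> z x)"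
    unfolding pmf_bind using set_pmf_pert[OF z]
    by (subst integral_measure_pmf_real[of "{1..2 * k}"]) (auto simp: pmf_pert[OF z])
  also have "\<dots> = (\<Sum>i<k. (pmf (W (2 * i + 1)) y + pmf (W (2 * i + 2)) y) / (2 * real k)
      + (2 * \<epsilon> * z i) * (pmf (W (2 * i + 1)) y - pmf (W (2 * i + 2)) y) / (2 * real k))"
    unfolding sum_pairs
  proof (intro sum.cong refl)
    fix i assume "i \<in> {..<k}"
    then have i: "i < k" by simp
    show "pmf (W (2 * i + 1)) y * pert_weight k \<epsilon> z (2 * i + 1) + pmf (W (2 * i + 2)) y * pert_weight k \<epsilon> z (2 * i + 2)
      = (pmf (W (2 * i + 1)) y + pmf (W (2 * i + 2)) y) / (2 * real k)
      + (2 * \<epsilon> * z i) * (pmf (W (2 * i + 1)) y - pmf (W (2 * i + 2)) y) / (2 * real k)"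
      unfolding pert_weight_pair[OF i] using k by (simp add: field_simps)
  qed
  also have "\<dots> = (\<Sum>i<k. pmf (W (2 * i + 1)) y + pmf (W (2 * i + 2)) y) / (2 * real k)
      + (\<Sum>i<k. (2 * \<epsilon> * z i) * (pair_bias k W i y * out_mass k W y) / (2 * real k))"
    by (simp add: sum.distrib pair_bias_mult_out_mass sum_divide_distrib add_divide_distrib)
  also have "\<dots> = pmf (unif_out k W) y * (1 + 2 * \<epsilon> * (\<Sum>i<k. z i * pair_bias k W i y))"
    unfolding mass pmf_unif_out[OF k]
    by (simp add: sum_distrib_left sum_distrib_right sum_divide_distrib distrib_left mult_ac)
  finally show ?thesis .
qed

lemma tv_dist_pert:
  assumes z: "z \<in> sign_cube k"
  shows "tv_dist (pert_pmf k \<epsilon> z) (pmf_of_set {1..2 * k}) \<ge> \<epsilon>"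
proof -
  let ?u = "pmf_of_set {1..2 * k}"
  \<comment> \<open>The symbols with raised mass, exactly one per pair, each with surplus
    \<open>\<epsilon> / k\<close>.\<close>
  define S where "S = {x \<in> {1..2 * k}. (if odd x then 1 else - 1) * z ((x - 1) div 2) = 1}"
  have u: "pmf ?u x = 1 / (2 * real k)" if "x \<in> {1..2 * k}" for x
    using that k by (subst pmf_of_set) auto
  have S: "S = {x \<in> {1..2 * k}. x \<in> S}" by (auto simp: S_def)
  have "measure_pmf.prob (pert_pmf k \<epsilon> z) S - measure_pmf.prob ?u S
      = (\<Sum>x\<in>S. pert_weight k \<epsilon> z x - pmf ?u x)"
    by (subst (1 2) measure_measure_pmf_finite) (auto simp: S_def pmf_pert[OF z] sum_subtractf)
  also have "\<dots> = (\<Sum>x = 1..2 * k. if x \<in> S then pert_weight k \<epsilon> z x - pmf ?u x else 0)"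
    by (subst S) (simp only: sum.inter_filter finite_atLeastAtMost)
  also have "\<dots> = (\<Sum>x = 1..2 * k. if x \<in> S then \<epsilon> / real k else 0)"
  proof (intro sum.cong refl if_cong)
    fix x assume "x \<in> {1..2 * k}" "x \<in> S"
    then have "pert_weight k \<epsilon> z x = (1 + 2 * \<epsilon> * 1) / (2 * real k)"
      by (simp only: S_def pert_weight_def mem_Collect_eq if_True)
    then show "pert_weight k \<epsilon> z x - pmf ?u x = \<epsilon> / real k"
      using k u[OF \<open>x \<in> {1..2 * k}\<close>] by (simp add: field_simps)
  qed
  also have "\<dots> = (\<Sum>i<k. \<epsilon> / real k)"
    unfolding sum_pairs
  proof (intro sum.cong refl)
    fix i assume "i \<in> {..<k}"
    then have "z i = 1 \<or> z i = - 1" "i < k"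
      using sign_cube_cases[OF z] by auto
    then show "(if 2 * i + 1 \<in> S then \<epsilon> / real k else 0) + (if 2 * i + 2 \<in> S then \<epsilon> / real k else 0) = \<epsilon> / real k"
      by (auto simp: S_def)
  qed
  also have "\<dots> = \<epsilon>" using k by simp
  finally have "\<epsilon> = measure_pmf.prob (pert_pmf k \<epsilon> z) S - measure_pmf.prob ?u S" ..
  also have "\<dots> \<le> tv_dist (pert_pmf k \<epsilon> z) ?u"
    unfolding tv_dist_def
  proof (rule cSUP_upper)
    show "bdd_above (range (\<lambda>S. measure_pmf.prob (pert_pmf k \<epsilon> z) S - measure_pmf.prob ?u S))"
    proof (rule bdd_aboveI2)
      fix S
      show "measure_pmf.prob (pert_pmf k \<epsilon> z) S - measure_pmf.prob ?u S \<le> 1"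
        using measure_pmf.prob_le_1[of "pert_pmf k \<epsilon> z" S] measure_nonneg[of "measure_pmf ?u" S] by linarith
    qed
  qed simp
  finally show ?thesis .
qed

end

section \<open>Divergence of the transcript laws\<close>

lemma length_transcript: "ys \<in> set_pmf (transcript sel p u n) \<Longrightarrow> length ys = n"
  by (induction n arbitrary: ys) auto

lemma transcript_Suc':
  "transcript sel p u (Suc n) = bind_pmf (transcript sel p u n)
     (\<lambda>ys. map_pmf (\<lambda>y. ys @ [y]) (bind_pmf p (sel ys u)))"
  by (simp add: map_bind_pmf)

lemma pmf_transcript_snoc:
  "pmf (transcript sel p u (Suc n)) (ys @ [y])
    = pmf (transcript sel p u n) ys * pmf (bind_pmf p (sel ys u)) y"
proof -
  have *: "pmf (map_pmf (\<lambda>y. xs @ [y]) q) (ys @ [y]) = (if xs = ys then pmf q y else 0)" for xs q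
  proof (cases "xs = ys")
    case True
    have "inj (\<lambda>y. ys @ [y])" by (auto intro: injI)
    from pmf_map_inj'[OF this, of q y] show ?thesis by (simp add: True)
  next
    case False
    then show ?thesis by (auto intro!: pmf_map_outside)
  qed
  show ?thesis
    unfolding transcript_Suc' pmf_bind[of "transcript sel p u n"] *
    by (subst integral_measure_pmf_real[of "{ys}"]) (auto split: if_splits)
qed

text \<open>With \<open>u\<close> frozen, each channel is a deterministic function of the previous
  outputs and all transcript laws are discrete.\<close>

locale fixed_randomness =
  fixes k :: nat and \<epsilon> :: real and sel :: "'y list \<Rightarrow> 'u \<Rightarrow> 'y channel" and u :: 'u
  assumes k: "k \<ge> 1" and eps: "0 < \<epsilon>" "\<epsilon> \<le> 1 / 2"
begin

definition null_law :: "nat \<Rightarrow> 'y list pmf" where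
  "null_law n = transcript sel (pmf_of_set {1..2 * k}) u n"

abbreviation pert_law :: "(nat \<Rightarrow> real) \<Rightarrow> nat \<Rightarrow> 'y list pmf" where
  "pert_law z n \<equiv> transcript sel (pert_pmf k \<epsilon> z) u n"

text \<open>The argument \<open>v\<close> is an arbitrary vector because the mixture moves along a
  weighted mean of sign vectors.\<close>

definition tilt :: "(nat \<Rightarrow> real) \<Rightarrow> 'y list \<Rightarrow> 'y \<Rightarrow> real" where
  "tilt v ys y = 2 * \<epsilon> * (\<Sum>i<k. v i * pair_bias k (sel ys u) i y)"

definition lik :: "(nat \<Rightarrow> real) \<Rightarrow> 'y list \<Rightarrow> real" where
  "lik z ys = (\<Prod>t<length ys. 1 + tilt z (take t ys) (ys ! t))"

definition mix_lik :: "'y list \<Rightarrow> real" where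
  "mix_lik ys = cube_avg k (\<lambda>z. lik z ys)"

text \<open>As \<open>lik z\<close> is a density with respect to \<open>null_law n\<close>, this is
  the average over \<open>z\<close> of the relative entropies of the perturbed laws. It is the
  \<open>J\<close> of the opening remark, and \<open>mix_div\<close> is the
  \<open>D\<close>.\<close>

definition avg_div :: "nat \<Rightarrow> real" where
  "avg_div n = measure_pmf.expectation (null_law n) (\<lambda>ys. cube_avg k (\<lambda>z. xlnx (lik z ys)))"

definition mix_div :: "nat \<Rightarrow> real" where
  "mix_div n = measure_pmf.expectation (null_law n) (\<lambda>ys. xlnx (mix_lik ys))"

lemma null_law_0: "null_law 0 = return_pmf []"
  by (simp add: null_law_def)

lemma null_law_Suc:
  "null_law (Suc n) = bind_pmf (null_law n) (\<lambda>ys. map_pmf (\<lambda>y. ys @ [y]) (unif_out k (sel ys u)))"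
  unfolding null_law_def unif_out_def by (rule transcript_Suc')

lemma pmf_null_law_snoc:
  "pmf (null_law (Suc n)) (ys @ [y]) = pmf (null_law n) ys * pmf (unif_out k (sel ys u)) y"
  unfolding null_law_def unif_out_def by (rule pmf_transcript_snoc)

lemma length_null_law: "ys \<in> set_pmf (null_law n) \<Longrightarrow> length ys = n"
  unfolding null_law_def by (rule length_transcript)

lemma lik_Nil [simp]: "lik z [] = 1"
  by (simp add: lik_def)

lemma lik_snoc: "lik z (ys @ [y]) = lik z ys + lik z ys * tilt z ys y"
proof -
  have "(\<Prod>t<length ys. 1 + tilt z (take t (ys @ [y])) ((ys @ [y]) ! t)) = lik z ys"
    unfolding lik_def by (intro prod.cong) (auto simp: nth_append)
  then show ?thesis
    by (simp add: lik_def algebra_simps)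
qed

lemma tilt_bound:
  assumes "\<And>i. i < k \<Longrightarrow> \<bar>v i\<bar> \<le> B" "0 \<le> B"
  shows "\<bar>tilt v ys y\<bar> \<le> B"
proof -
  have "\<bar>tilt v ys y\<bar> = 2 * \<epsilon> * \<bar>\<Sum>i<k. v i * pair_bias k (sel ys u) i y\<bar>"
    using eps by (simp add: tilt_def abs_mult)
  also have "\<dots> \<le> 1 * B"
    using eps assms by (intro mult_mono abs_sum_pair_bias_le) auto
  finally show ?thesis by simp
qed

lemma tilt_sign_bound: "z \<in> sign_cube k \<Longrightarrow> \<bar>tilt z ys y\<bar> \<le> 1"
  using sign_cube_cases[of z k] by (intro tilt_bound) fastforce+

text \<open>Every factor lies between 0 and 2 because \<open>2 * \<epsilon> \<le> 1\<close>. For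
  transcripts of fixed length this bounds all functions below, which settles integrability.\<close>

lemma lik_bounds:
  assumes "z \<in> sign_cube k"
  shows "0 \<le> lik z ys" "lik z ys \<le> 2 ^ length ys"
proof -
  have "0 \<le> 1 + tilt z xs y" "1 + tilt z xs y \<le> 2" for xs y
    using tilt_sign_bound[OF assms, of xs y] by (auto simp: abs_le_iff)
  then show "0 \<le> lik z ys" "lik z ys \<le> 2 ^ length ys"
    using prod_mono[of "{..<length ys}" "\<lambda>t. 1 + tilt z (take t ys) (ys ! t)" "\<lambda>_. 2"]
    by (auto simp: lik_def intro!: prod_nonneg)
qed

lemma mix_lik_bounds: "0 \<le> mix_lik ys" "mix_lik ys \<le> 2 ^ length ys"
  using cube_avg_mono[of k "\<lambda>z. lik z ys" "\<lambda>_. 2 ^ length ys"] lik_bounds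
  by (auto simp: mix_lik_def intro!: cube_avg_nonneg)

lemma pmf_pert_law:
  assumes z: "z \<in> sign_cube k"
  shows "pmf (pert_law z n) ys = pmf (null_law n) ys * lik z ys"
proof (induction n arbitrary: ys)
  case 0
  then show ?case by (cases "ys = []") (auto simp: null_law_0)
next
  case (Suc n)
  show ?case
  proof (cases ys rule: rev_cases)
    case Nil
    then have "ys \<notin> set_pmf (pert_law z (Suc n))" "ys \<notin> set_pmf (null_law (Suc n))"
      using length_transcript length_null_law by force+
    then show ?thesis by (metis mult_zero_left pmf_eq_0_set_pmf)
  next
    case (snoc xs y)
    show ?thesis
      unfolding snoc pmf_transcript_snoc pmf_null_law_snoc lik_snoc Suc.IH pmf_bind_pert[OF k eps z]
      by (simp add: tilt_def algebra_simps)
  qed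
qed

lemma expectation_pert_law:
  "z \<in> sign_cube k \<Longrightarrow> measure_pmf.expectation (pert_law z n) f
    = measure_pmf.expectation (null_law n) (\<lambda>ys. lik z ys * f ys)"
  by (simp add: pmf_expectation_eq_infsetsum pmf_pert_law mult_ac)

lemma integrable_null:
  fixes f :: "'y list \<Rightarrow> real"
  assumes "\<And>ys. length ys = n \<Longrightarrow> \<bar>f ys\<bar> \<le> B"
  shows "integrable (measure_pmf (null_law n)) f"
  by (rule integrable_pmf_bounded, rule assms, rule length_null_law)

lemma expectation_null_Suc:
  fixes f :: "'y list \<Rightarrow> real"
  assumes "\<And>ys. length ys = Suc n \<Longrightarrow> \<bar>f ys\<bar> \<le> B"
  shows "measure_pmf.expectation (null_law (Suc n)) f
    = measure_pmf.expectation (null_law n) (\<lambda>ys. measure_pmf.expectation (unif_out k (sel ys u)) (\<lambda>y. f (ys @ [y])))"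
proof -
  have "\<bar>f ys\<bar> \<le> B"
    if "ys \<in> set_pmf (bind_pmf (null_law n) (\<lambda>ys. map_pmf (\<lambda>y. ys @ [y]) (unif_out k (sel ys u))))" for ys
    using that length_null_law by (intro assms) auto
  from expectation_bind_bounded[of "null_law n" "\<lambda>ys. map_pmf (\<lambda>y. ys @ [y]) (unif_out k (sel ys u))" f B, OF this]
  show ?thesis by (simp add: null_law_Suc)
qed

lemma abs_xlnx_lik_le:
  "z \<in> sign_cube k \<Longrightarrow> length ys = n \<Longrightarrow> \<bar>xlnx (lik z ys)\<bar> \<le> (2 ^ n)\<^sup>2 + 1"
  using abs_xlnx_le lik_bounds by blast

lemma integrable_avg_div: "integrable (measure_pmf (null_law n)) (\<lambda>ys. cube_avg k (\<lambda>z. xlnx (lik z ys)))"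
  by (rule integrable_null[of _ _ "(2 ^ n)\<^sup>2 + 1"], rule abs_cube_avg_le, rule abs_xlnx_lik_le)

lemma abs_xlnx_mix_lik_le: "length ys = n \<Longrightarrow> \<bar>xlnx (mix_lik ys)\<bar> \<le> (2 ^ n)\<^sup>2 + 1"
  using abs_xlnx_le mix_lik_bounds by blast

lemma integrable_mix_div: "integrable (measure_pmf (null_law n)) (\<lambda>ys. xlnx (mix_lik ys))"
  by (rule integrable_null, rule abs_xlnx_mix_lik_le)

lemma integrable_mix_lik: "integrable (measure_pmf (null_law n)) mix_lik"
  using mix_lik_bounds by (intro integrable_null[of _ _ "2 ^ n"]) auto

lemma integrable_lik_mult:
  fixes d :: "'y list \<Rightarrow> real"
  assumes "z \<in> sign_cube k" "\<And>ys. \<bar>d ys\<bar> \<le> 1"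
  shows "integrable (measure_pmf (null_law n)) (\<lambda>ys. lik z ys * d ys)"
proof (rule integrable_null)
  fix ys :: "'y list" assume "length ys = n"
  then have "\<bar>lik z ys\<bar> * \<bar>d ys\<bar> \<le> 2 ^ n * 1"
    using lik_bounds[OF assms(1), of ys] assms(2) by (intro mult_mono) auto
  then show "\<bar>lik z ys * d ys\<bar> \<le> 2 ^ n" by (simp add: abs_mult)
qed

lemma expectation_mix_lik_mult:
  fixes d :: "'y list \<Rightarrow> real"
  assumes "\<And>ys. \<bar>d ys\<bar> \<le> 1"
  shows "measure_pmf.expectation (null_law n) (\<lambda>ys. mix_lik ys * d ys)
    = cube_avg k (\<lambda>z. measure_pmf.expectation (pert_law z n) d)"
proof -
  have "(\<lambda>ys. mix_lik ys * d ys) = (\<lambda>ys. cube_avg k (\<lambda>z. lik z ys * d ys))"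
    unfolding mix_lik_def using cube_avg_mult_left by (auto simp: mult.commute)
  then have "measure_pmf.expectation (null_law n) (\<lambda>ys. mix_lik ys * d ys)
      = cube_avg k (\<lambda>z. measure_pmf.expectation (null_law n) (\<lambda>ys. lik z ys * d ys))"
    using integrable_lik_mult assms by (simp add: expectation_cube_avg)
  also have "\<dots> = cube_avg k (\<lambda>z. measure_pmf.expectation (pert_law z n) d)"
    by (intro cube_avg_cong) (simp add: expectation_pert_law)
  finally show ?thesis .
qed

lemma expectation_mix_lik: "measure_pmf.expectation (null_law n) mix_lik = 1"
  using expectation_mix_lik_mult[of "\<lambda>_. 1" n] by simp

lemma mix_div_nonneg: "0 \<le> mix_div n"
proof -
  have "measure_pmf.expectation (null_law n) (\<lambda>ys. mix_lik ys - 1) \<le> mix_div n"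
    unfolding mix_div_def using integrable_mix_lik integrable_mix_div xlnx_ge mix_lik_bounds
    by (intro expectation_mono) auto
  then show ?thesis using integrable_mix_lik by (simp add: expectation_mix_lik)
qed

lemma expectation_tilt_sq:
  "measure_pmf.expectation (unif_out k (sel ys u)) (\<lambda>y. (tilt v ys y)\<^sup>2)
    = 2 * \<epsilon>\<^sup>2 / real k * quad_form k (info_coeff k (sel ys u)) v"
  using k by (simp add: tilt_def power_mult_distrib quad_form_info field_simps)

lemma expectation_tilt: "measure_pmf.expectation (unif_out k (sel ys u)) (tilt v ys) = 0"
  unfolding tilt_def using k by (simp add: expectation_sum_pair_bias)

text \<open>By linearity of \<open>tilt\<close> the mixture moves along the vector of
  \<open>lik\<close>-weighted sign averages, which is \<open>mix_lik ys\<close> times the posterior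
  mean.\<close>

lemma mix_lik_snoc: "mix_lik (ys @ [y]) = mix_lik ys + tilt (\<lambda>i. cube_avg k (\<lambda>z. lik z ys * z i)) ys y"
proof -
  have "cube_avg k (\<lambda>z. lik z ys * tilt z ys y)
      = (\<Sum>i<k. cube_avg k (\<lambda>z. (2 * \<epsilon> * pair_bias k (sel ys u) i y) * (lik z ys * z i)))"
    by (simp add: tilt_def sum_distrib_left cube_avg_sum[symmetric] mult_ac)
  also have "\<dots> = tilt (\<lambda>i. cube_avg k (\<lambda>z. lik z ys * z i)) ys y"
    by (simp only: cube_avg_mult_left) (simp add: tilt_def sum_distrib_left mult_ac)
  finally show ?thesis
    by (simp add: mix_lik_def lik_snoc cube_avg_add)
qed

section \<open>One-round recursions for the two divergences\<close>

context
  fixes n :: nat and a \<tau> :: real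
  assumes a: "0 \<le> a"
    and op: "\<And>ys v. length ys = n \<Longrightarrow> quad_form k (info_coeff k (sel ys u)) v \<le> a * (\<Sum>i<k. (v i)\<^sup>2)"
    and tr: "\<And>ys. length ys = n \<Longrightarrow> (\<Sum>i<k. info_coeff k (sel ys u) i i) \<le> \<tau>"
begin

text \<open>Given the past, the increment for each \<open>z\<close> is bounded by the information
  form at \<open>z\<close>. Averaging against \<open>lik z ys\<close> and applying
  \<open>sign_cube_quad_form_entropy\<close> leaves the trace and the posterior entropy, whose
  expectation is \<open>avg_div n - mix_div n\<close>.\<close>

lemma avg_div_Suc: "avg_div (Suc n) \<le> avg_div n + 2 * \<epsilon>\<^sup>2 / real k * (2 * \<tau> + 4 * a * (avg_div n - mix_div n))"
proof -
  define \<alpha> where "\<alpha> = 2 * \<epsilon>\<^sup>2 / real k"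
  have \<alpha>: "0 \<le> \<alpha>" by (simp add: \<alpha>_def)
  let ?H = "\<lambda>ys. cube_avg k (\<lambda>z. xlnx (lik z ys))"
  have step: "measure_pmf.expectation (unif_out k (sel ys u)) (\<lambda>y. ?H (ys @ [y]))
      \<le> ?H ys + \<alpha> * (2 * \<tau> * mix_lik ys + 4 * a * (?H ys - xlnx (mix_lik ys)))"
    if len: "length ys = n" for ys
  proof -
    let ?p = "unif_out k (sel ys u)"
    have "measure_pmf.expectation ?p (\<lambda>y. ?H (ys @ [y]))
        = cube_avg k (\<lambda>z. measure_pmf.expectation ?p (\<lambda>y. xlnx (lik z (ys @ [y]))))"
      using abs_xlnx_lik_le[of _ _ "Suc n"] len
      by (intro expectation_cube_avg integrable_pmf_bounded[of _ _ "(2 ^ Suc n)\<^sup>2 + 1"]) auto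
    also have "\<dots> \<le> cube_avg k (\<lambda>z. xlnx (lik z ys) + \<alpha> * (lik z ys * quad_form k (info_coeff k (sel ys u)) z))"
    proof (rule cube_avg_mono)
      fix z assume z: "z \<in> sign_cube k"
      have nn: "0 \<le> lik z ys + lik z ys * tilt z ys y" for y
        using lik_bounds(1)[OF z, of "ys @ [y]"] by (simp add: lik_snoc)
      have "measure_pmf.expectation ?p (\<lambda>y. xlnx (lik z ys + lik z ys * tilt z ys y))
          \<le> xlnx (lik z ys) + measure_pmf.expectation ?p (\<lambda>y. (lik z ys * tilt z ys y)\<^sup>2) / lik z ys"
        using lik_bounds(1)[OF z, of ys] nn mult_left_mono[OF tilt_sign_bound[OF z, of ys], of "lik z ys"]
        by (intro expectation_xlnx_step[where B = "lik z ys"]) (auto simp: abs_mult expectation_tilt)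
      also have "measure_pmf.expectation ?p (\<lambda>y. (lik z ys * tilt z ys y)\<^sup>2) / lik z ys
          = \<alpha> * (lik z ys * quad_form k (info_coeff k (sel ys u)) z)"
      proof -
        have "measure_pmf.expectation ?p (\<lambda>y. (lik z ys * tilt z ys y)\<^sup>2)
            = lik z ys * lik z ys * (\<alpha> * quad_form k (info_coeff k (sel ys u)) z)"
          by (simp add: power_mult_distrib expectation_tilt_sq \<alpha>_def power2_eq_square[of "lik z ys"])
        then show ?thesis by simp
      qed
      finally show "measure_pmf.expectation ?p (\<lambda>y. xlnx (lik z (ys @ [y])))
          \<le> xlnx (lik z ys) + \<alpha> * (lik z ys * quad_form k (info_coeff k (sel ys u)) z)"
        by (simp add: lik_snoc)
    qed
    also have "\<dots> = ?H ys + \<alpha> * cube_avg k (\<lambda>z. lik z ys * quad_form k (info_coeff k (sel ys u)) z)"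
      by (simp add: cube_avg_add cube_avg_mult_left)
    \<comment> \<open>The difference \<open>?H ys - xlnx (mix_lik ys)\<close> is
      \<open>mix_lik ys\<close> times the relative entropy of the posterior law of \<open>z\<close>
      to the uniform law.\<close>
    also have "\<dots> \<le> ?H ys + \<alpha> * (2 * (\<Sum>i<k. info_coeff k (sel ys u) i i) * mix_lik ys
        + 4 * a * (?H ys - xlnx (mix_lik ys)))"
      unfolding mix_lik_def using lik_bounds op[OF len] a \<alpha> quad_form_info_nonneg[OF k]
      by (intro add_left_mono mult_left_mono sign_cube_quad_form_entropy) auto
    also have "\<dots> \<le> ?H ys + \<alpha> * (2 * \<tau> * mix_lik ys + 4 * a * (?H ys - xlnx (mix_lik ys)))"
      using tr[OF len] mix_lik_bounds \<alpha> by (intro add_left_mono mult_left_mono add_right_mono mult_right_mono) auto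
    finally show ?thesis .
  qed
  have bH: "\<bar>?H ys\<bar> \<le> (2 ^ m)\<^sup>2 + 1" if "length ys = m" for ys m
    using that by (intro abs_cube_avg_le abs_xlnx_lik_le)
  have int: "integrable (measure_pmf (null_law n)) (\<lambda>ys. measure_pmf.expectation (unif_out k (sel ys u)) (\<lambda>y. ?H (ys @ [y])))"
  proof (rule integrable_null[of _ _ "(2 ^ Suc n)\<^sup>2 + 1"])
    fix ys :: "'y list" assume len: "length ys = n"
    then have b: "\<bar>?H (ys @ [y])\<bar> \<le> (2 ^ Suc n)\<^sup>2 + 1" for y by (intro bH) simp
    then have "integrable (measure_pmf (unif_out k (sel ys u))) (\<lambda>y. ?H (ys @ [y]))"
      by (rule integrable_pmf_bounded)
    then have "measure_pmf.expectation (unif_out k (sel ys u)) (\<lambda>y. \<bar>?H (ys @ [y])\<bar>) \<le> (2 ^ Suc n)\<^sup>2 + 1"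
      using b by (intro measure_pmf.integral_le_const) auto
    then show "\<bar>measure_pmf.expectation (unif_out k (sel ys u)) (\<lambda>y. ?H (ys @ [y]))\<bar> \<le> (2 ^ Suc n)\<^sup>2 + 1"
      by (rule order_trans[OF integral_abs_bound])
  qed
  have "avg_div (Suc n) = measure_pmf.expectation (null_law n)
      (\<lambda>ys. measure_pmf.expectation (unif_out k (sel ys u)) (\<lambda>y. ?H (ys @ [y])))"
    unfolding avg_div_def by (rule expectation_null_Suc[OF bH])
  also have "\<dots> \<le> measure_pmf.expectation (null_law n)
      (\<lambda>ys. ?H ys + \<alpha> * (2 * \<tau> * mix_lik ys + 4 * a * (?H ys - xlnx (mix_lik ys))))"
    by (intro expectation_mono int Bochner_Integration.integrable_add integrable_mult_right
        Bochner_Integration.integrable_diff integrable_mix_lik integrable_mix_div integrable_avg_div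
        step length_null_law)
  also have "\<dots> = avg_div n + \<alpha> * (2 * \<tau> + 4 * a * (avg_div n - mix_div n))"
    using integrable_mix_lik[of n] integrable_mix_div[of n] integrable_avg_div[of n]
    by (simp add: avg_div_def mix_div_def expectation_mix_lik)
  finally show ?thesis by (simp add: \<alpha>_def)
qed

text \<open>The mixture moves along \<open>M\<close>, whose squared length is at most
  \<open>2 * mix_lik ys\<close> times the unnormalized posterior entropy; the factor
  \<open>mix_lik ys\<close> cancels the division in the chi-square step. No trace term
  appears.\<close>

lemma mix_div_Suc: "mix_div (Suc n) \<le> mix_div n + 2 * \<epsilon>\<^sup>2 / real k * (2 * a * (avg_div n - mix_div n))"
proof -
  define \<alpha> where "\<alpha> = 2 * \<epsilon>\<^sup>2 / real k"
  have \<alpha>: "0 \<le> \<alpha>" by (simp add: \<alpha>_def)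
  let ?H = "\<lambda>ys. cube_avg k (\<lambda>z. xlnx (lik z ys))"
  have step: "measure_pmf.expectation (unif_out k (sel ys u)) (\<lambda>y. xlnx (mix_lik (ys @ [y])))
      \<le> xlnx (mix_lik ys) + \<alpha> * (2 * a * (?H ys - xlnx (mix_lik ys)))"
    if len: "length ys = n" for ys
  proof -
    let ?p = "unif_out k (sel ys u)"
    define M where "M i = cube_avg k (\<lambda>z. lik z ys * z i)" for i
    define E where "E = ?H ys - xlnx (mix_lik ys)"
    have snoc: "mix_lik (ys @ [y]) = mix_lik ys + tilt M ys y" for y
      by (simp add: mix_lik_snoc M_def[abs_def])
    have M: "(\<Sum>i<k. (M i)\<^sup>2) \<le> 2 * mix_lik ys * E"
      using sign_cube_first_moment_entropy[of k "\<lambda>z. lik z ys"] lik_bounds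
      by (simp add: M_def mix_lik_def E_def)
    have Mb: "\<bar>M i\<bar> \<le> mix_lik ys" if i: "i < k" for i
    proof -
      have "lik z ys * z i \<le> lik z ys" "- lik z ys \<le> lik z ys * z i" if "z \<in> sign_cube k" for z
        using lik_bounds(1)[OF that, of ys] sign_cube_cases[OF that i] by auto
      then have "M i \<le> mix_lik ys" "cube_avg k (\<lambda>z. (- 1) * lik z ys) \<le> M i"
        unfolding M_def mix_lik_def by (auto intro!: cube_avg_mono)
      then show ?thesis unfolding cube_avg_mult_left by (simp add: mix_lik_def)
    qed
    have "measure_pmf.expectation ?p (\<lambda>y. xlnx (mix_lik ys + tilt M ys y))
        \<le> xlnx (mix_lik ys) + measure_pmf.expectation ?p (\<lambda>y. (tilt M ys y)\<^sup>2) / mix_lik ys"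
    proof (rule expectation_xlnx_step)
      show b: "\<bar>tilt M ys y\<bar> \<le> mix_lik ys" for y
        using Mb mix_lik_bounds by (intro tilt_bound) auto
      show "tilt M ys y = 0" if "mix_lik ys = 0" for y
        using b[of y] that by simp
      show "0 \<le> mix_lik ys + tilt M ys y" for y
        using mix_lik_bounds(1)[of "ys @ [y]"] by (simp add: snoc)
    qed (use mix_lik_bounds expectation_tilt in auto)
    also have "measure_pmf.expectation ?p (\<lambda>y. (tilt M ys y)\<^sup>2) / mix_lik ys \<le> \<alpha> * (2 * a * E)"
    proof (cases "mix_lik ys = 0")
      case True
      have "xlnx (lik z ys) = 0" if "z \<in> sign_cube k" for z
        using True lik_bounds(1) that by (simp add: mix_lik_def cube_avg_def sum_nonneg_eq_0_iff)
      then have "?H ys = cube_avg k (\<lambda>_. 0)" by (intro cube_avg_cong)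
      then have "E = 0" using True by (simp add: E_def)
      then show ?thesis using True by simp
    next
      case False
      then have pos: "0 < mix_lik ys" using mix_lik_bounds(1)[of ys] by simp
      have "measure_pmf.expectation ?p (\<lambda>y. (tilt M ys y)\<^sup>2) \<le> \<alpha> * (a * (\<Sum>i<k. (M i)\<^sup>2))"
        unfolding expectation_tilt_sq \<alpha>_def[symmetric] using \<alpha> op[OF len] by (intro mult_left_mono) auto
      also have "\<dots> \<le> \<alpha> * (a * (2 * mix_lik ys * E))"
        using M \<alpha> a by (intro mult_left_mono)
      finally show ?thesis using pos by (simp add: field_simps)
    qed
    finally show ?thesis by (simp add: snoc E_def)
  qed
  have int: "integrable (measure_pmf (null_law n)) (\<lambda>ys. measure_pmf.expectation (unif_out k (sel ys u)) (\<lambda>y. xlnx (mix_lik (ys @ [y]))))"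
  proof (rule integrable_null[of _ _ "(2 ^ Suc n)\<^sup>2 + 1"])
    fix ys :: "'y list" assume len: "length ys = n"
    then have b: "\<bar>xlnx (mix_lik (ys @ [y]))\<bar> \<le> (2 ^ Suc n)\<^sup>2 + 1" for y
      by (intro abs_xlnx_mix_lik_le) simp
    then have "integrable (measure_pmf (unif_out k (sel ys u))) (\<lambda>y. xlnx (mix_lik (ys @ [y])))"
      by (rule integrable_pmf_bounded)
    then have "measure_pmf.expectation (unif_out k (sel ys u)) (\<lambda>y. \<bar>xlnx (mix_lik (ys @ [y]))\<bar>) \<le> (2 ^ Suc n)\<^sup>2 + 1"
      using b by (intro measure_pmf.integral_le_const) auto
    then show "\<bar>measure_pmf.expectation (unif_out k (sel ys u)) (\<lambda>y. xlnx (mix_lik (ys @ [y])))\<bar> \<le> (2 ^ Suc n)\<^sup>2 + 1"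
      by (rule order_trans[OF integral_abs_bound])
  qed
  have "mix_div (Suc n) = measure_pmf.expectation (null_law n)
      (\<lambda>ys. measure_pmf.expectation (unif_out k (sel ys u)) (\<lambda>y. xlnx (mix_lik (ys @ [y]))))"
    unfolding mix_div_def by (rule expectation_null_Suc[OF abs_xlnx_mix_lik_le])
  also have "\<dots> \<le> measure_pmf.expectation (null_law n)
      (\<lambda>ys. xlnx (mix_lik ys) + \<alpha> * (2 * a * (?H ys - xlnx (mix_lik ys))))"
    by (intro expectation_mono int Bochner_Integration.integrable_add integrable_mult_right
        Bochner_Integration.integrable_diff integrable_mix_div integrable_avg_div
        step length_null_law)
  also have "\<dots> = mix_div n + \<alpha> * (2 * a * (avg_div n - mix_div n))"
    using integrable_mix_div[of n] integrable_avg_div[of n]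
    by (simp add: avg_div_def mix_div_def)
  finally show ?thesis by (simp add: \<alpha>_def)
qed

end

section \<open>Solving the recursions and comparing with a test\<close>

lemma avg_div_0: "avg_div 0 = 0" and mix_div_0: "mix_div 0 = 0"
  by (simp_all add: avg_div_def mix_div_def mix_lik_def null_law_0)

text \<open>By \<open>small\<close>, the feedback of \<open>avg_div\<close> into its own recursion
  adds at most another \<open>4 * \<beta> * \<tau>\<close> per round, so its growth stays linear.
  Inserting this into the recursion of \<open>mix_div\<close> gives the quadratic bound, with
  \<open>32 = 4 * 8\<close>.\<close>

lemma mix_div_le:
  assumes a: "0 \<le> a" and \<tau>: "0 \<le> \<tau>"
    and op: "\<And>ys v. length ys < n \<Longrightarrow> quad_form k (info_coeff k (sel ys u)) v \<le> a * (\<Sum>i<k. (v i)\<^sup>2)"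
    and tr: "\<And>ys. length ys < n \<Longrightarrow> (\<Sum>i<k. info_coeff k (sel ys u) i i) \<le> \<tau>"
    and small: "16 * (\<epsilon>\<^sup>2 / real k) * a * real n \<le> 1"
  shows "mix_div n \<le> 32 * (real n * (\<epsilon>\<^sup>2 / real k))\<^sup>2 * (a * \<tau>)"
proof -
  define \<beta> where "\<beta> = \<epsilon>\<^sup>2 / real k"
  have \<beta>: "0 \<le> \<beta>" by (simp add: \<beta>_def)
  have J: "avg_div t \<le> 8 * \<beta> * \<tau> * real t" if "t \<le> n" for t
    using that
  proof (induction t)
    case 0
    then show ?case by (simp add: avg_div_0)
  next
    case (Suc t)
    then have IH: "avg_div t \<le> 8 * \<beta> * \<tau> * real t" and t: "t < n" by auto
    have "avg_div (Suc t) \<le> avg_div t + 2 * \<epsilon>\<^sup>2 / real k * (2 * \<tau> + 4 * a * (avg_div t - mix_div t))"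
      using a op tr t by (intro avg_div_Suc) auto
    also have "\<dots> = avg_div t + 4 * \<beta> * \<tau> + 8 * \<beta> * a * (avg_div t - mix_div t)"
      by (simp add: \<beta>_def algebra_simps diff_divide_distrib)
    also have "8 * \<beta> * a * (avg_div t - mix_div t) \<le> 8 * \<beta> * a * (8 * \<beta> * \<tau> * real n)"
    proof (intro mult_left_mono)
      have "8 * \<beta> * \<tau> * real t \<le> 8 * \<beta> * \<tau> * real n"
        using t \<beta> \<tau> by (intro mult_left_mono) auto
      then show "avg_div t - mix_div t \<le> 8 * \<beta> * \<tau> * real n"
        using IH mix_div_nonneg[of t] by linarith
    qed (use \<beta> a in auto)
    also have "8 * \<beta> * a * (8 * \<beta> * \<tau> * real n) = (4 * \<beta> * \<tau>) * (16 * \<beta> * a * real n)"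
      by simp
    also have "\<dots> \<le> (4 * \<beta> * \<tau>) * 1"
      using small \<beta> \<tau> by (intro mult_left_mono) (auto simp: \<beta>_def)
    finally show ?case using IH by (simp add: algebra_simps)
  qed
  have "mix_div t \<le> real t * (4 * \<beta> * a * (8 * \<beta> * \<tau> * real n))" if "t \<le> n" for t
    using that
  proof (induction t)
    case 0
    then show ?case by (simp add: mix_div_0)
  next
    case (Suc t)
    then have IH: "mix_div t \<le> real t * (4 * \<beta> * a * (8 * \<beta> * \<tau> * real n))" and t: "t < n" by auto
    have "mix_div (Suc t) \<le> mix_div t + 2 * \<epsilon>\<^sup>2 / real k * (2 * a * (avg_div t - mix_div t))"
      using a op tr t by (intro mix_div_Suc) auto
    also have "\<dots> = mix_div t + 4 * \<beta> * a * (avg_div t - mix_div t)"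
      by (simp add: \<beta>_def)
    also have "4 * \<beta> * a * (avg_div t - mix_div t) \<le> 4 * \<beta> * a * (8 * \<beta> * \<tau> * real n)"
    proof (intro mult_left_mono)
      have "8 * \<beta> * \<tau> * real t \<le> 8 * \<beta> * \<tau> * real n"
        using t \<beta> \<tau> by (intro mult_left_mono) auto
      then show "avg_div t - mix_div t \<le> 8 * \<beta> * \<tau> * real n"
        using J[of t] t mix_div_nonneg[of t] by linarith
    qed (use \<beta> a in auto)
    finally show ?case using IH by (simp add: algebra_simps)
  qed
  from this[of n] show ?thesis
    unfolding \<beta>_def[symmetric] by (simp add: power2_eq_square mult_ac)
qed

text \<open>A variational bound with the acceptance probability \<open>d\<close> as test function:
  Young's inequality and \<open>exp d \<le> 1 + 2 * d\<close> on the unit interval give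
  \<open>97/100 \<le> mix_div n + 2 * (3/100)\<close>.\<close>

lemma mix_div_ge:
  fixes d :: "'y list \<Rightarrow> real"
  assumes d: "\<And>ys. 0 \<le> d ys" "\<And>ys. d ys \<le> 1"
    and null: "measure_pmf.expectation (null_law n) d \<le> 3 / 100"
    and alt: "cube_avg k (\<lambda>z. measure_pmf.expectation (pert_law z n) d) \<ge> 97 / 100"
  shows "1 / 2 \<le> mix_div n"
proof -
  have intd: "integrable (measure_pmf (null_law n)) d"
    using d by (intro integrable_null[of _ _ 1]) auto
  have "mix_lik ys * d ys \<le> 2 ^ length ys * 1" for ys
    using d mix_lik_bounds by (intro mult_mono) auto
  then have intm: "integrable (measure_pmf (null_law n)) (\<lambda>ys. mix_lik ys * d ys)"
    using d mix_lik_bounds by (intro integrable_null[of _ _ "2 ^ n"]) auto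
  have "mix_lik ys * d ys \<le> xlnx (mix_lik ys) - mix_lik ys + (1 + 2 * d ys)" for ys
  proof -
    have "exp (d ys) \<le> 1 + d ys + (d ys)\<^sup>2"
      using d by (intro exp_bound)
    also have "\<dots> \<le> 1 + 2 * d ys"
      using d[of ys] mult_left_le[of "d ys" "d ys"] by (simp add: power2_eq_square)
    finally show ?thesis
      using mult_le_xlnx_exp[OF mix_lik_bounds(1), of ys "d ys"] by linarith
  qed
  then have "measure_pmf.expectation (null_law n) (\<lambda>ys. mix_lik ys * d ys)
      \<le> measure_pmf.expectation (null_law n) (\<lambda>ys. xlnx (mix_lik ys) - mix_lik ys + (1 + 2 * d ys))"
    using intm intd integrable_mix_div integrable_mix_lik by (intro expectation_mono) auto
  also have "\<dots> = mix_div n + 2 * measure_pmf.expectation (null_law n) d"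
    using intd integrable_mix_div integrable_mix_lik
    by (simp add: mix_div_def expectation_mix_lik)
  finally show ?thesis
    using expectation_mix_lik_mult[of d n] d null alt by (simp add: abs_le_iff)
qed

end

section \<open>The lower bound\<close>

lemma uniformity_test_lower_bound:
  fixes \<W> :: "'y channel set" and M :: "'u measure"
  assumes k: "k \<ge> 1" and eps: "0 < \<epsilon>" "\<epsilon> \<le> 1 / 2"
    and test: "uniformity_test k \<epsilon> \<W> n M sel dec"
    and op: "\<And>W. W \<in> \<W> \<Longrightarrow> op_norm (channel_info_matrix k W) \<le> a"
    and tr: "\<And>W. W \<in> \<W> \<Longrightarrow> (\<Sum>i<k. info_coeff k W i i) \<le> \<tau>"
    and a: "0 \<le> a" "a \<le> \<tau>"
  shows "real k \<le> 16 * real n * \<epsilon>\<^sup>2 * sqrt (a * \<tau>)"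
proof -
  let ?u = "pmf_of_set {1..2 * k}"
  have prot: "prob_space M" "\<And>ys u. length ys < n \<Longrightarrow> u \<in> space M \<Longrightarrow> sel ys u \<in> \<W>"
    using test by (auto simp: uniformity_test_def interactive_protocol_def)
  interpret M: prob_space M by (rule prot)
  define F where "F u = pmf (bind_pmf (transcript sel ?u u n) (\<lambda>ys. dec ys u)) False" for u
  define G where "G z u = pmf (bind_pmf (transcript sel (pert_pmf k \<epsilon> z) u n) (\<lambda>ys. dec ys u)) True" for z u
  have F: "(\<integral>u. F u \<partial>M) \<ge> 99 / 100"
    using test by (simp add: uniformity_test_def decision_prob_def F_def)
  have G: "(\<integral>u. G z u \<partial>M) \<ge> 99 / 100" if "z \<in> sign_cube k" for z
    using test set_pmf_pert[OF k eps that] tv_dist_pert[OF k eps that]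
    unfolding uniformity_test_def decision_prob_def G_def by blast
  \<comment> \<open>The integral of a nonintegrable function is 0 by convention, so a value of at
    least \<open>99/100\<close> already forces integrability.\<close>
  have intF: "integrable M F"
    using F not_integrable_integral_eq[of M F] by fastforce
  have intG: "integrable M (G z)" if "z \<in> sign_cube k" for z
    using G[OF that] not_integrable_integral_eq[of M "G z"] by fastforce
  have intGs: "integrable M (\<lambda>u. cube_avg k (\<lambda>z. G z u))"
    unfolding cube_avg_def using intG by auto
  have "(\<integral>u. cube_avg k (\<lambda>z. G z u) \<partial>M) = cube_avg k (\<lambda>z. \<integral>u. G z u \<partial>M)"
    unfolding cube_avg_def using intG by (simp add: Bochner_Integration.integral_sum)
  also have "\<dots> \<ge> cube_avg k (\<lambda>_. 99 / 100)"
    using G by (rule cube_avg_mono)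
  finally have tot: "(\<integral>u. F u + cube_avg k (\<lambda>z. G z u) \<partial>M) \<ge> 198 / 100"
    using F intF intGs by simp
  \<comment> \<open>Some \<open>u\<close> is good for the null law and for the mixture
    simultaneously. Both summands are at most 1, so each is at least \<open>97/100\<close>
    there.\<close>
  have "\<exists>u\<in>space M. F u + cube_avg k (\<lambda>z. G z u) \<ge> 197 / 100"
  proof (rule ccontr)
    assume "\<not> ?thesis"
    then have "(\<integral>u. F u + cube_avg k (\<lambda>z. G z u) \<partial>M) \<le> 197 / 100"
      using intF intGs by (intro M.integral_le_const AE_I2) auto
    with tot show False by simp
  qed
  then obtain u where u: "u \<in> space M" "F u + cube_avg k (\<lambda>z. G z u) \<ge> 197 / 100" by blast
  interpret fixed_randomness k \<epsilon> sel u
    using k eps by unfold_locales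
  define d where "d ys = pmf (dec ys u) True" for ys
  have G_eq: "G z u = measure_pmf.expectation (pert_law z n) d" for z
    by (simp add: G_def d_def[abs_def] pmf_bind)
  have F_eq: "F u = 1 - measure_pmf.expectation (null_law n) d"
    unfolding F_def by (subst pmf_False_conv_True) (simp add: d_def[abs_def] pmf_bind null_law_def)
  have "F u \<le> 1" by (simp add: F_def pmf_le_1)
  moreover have "cube_avg k (\<lambda>z. G z u) \<le> cube_avg k (\<lambda>_. 1)"
    by (intro cube_avg_mono) (simp add: G_def pmf_le_1)
  ultimately have D: "1 / 2 \<le> mix_div n"
    using u(2) by (intro mix_div_ge[of d]) (auto simp: d_def[symmetric] G_eq F_eq, auto simp: d_def pmf_le_1)
  have \<tau>: "0 \<le> \<tau>" using a by simp
  have sq: "a \<le> sqrt (a * \<tau>)"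
    using a by (intro real_le_rsqrt) (simp add: power2_eq_square mult_left_mono)
  define \<beta> where "\<beta> = \<epsilon>\<^sup>2 / real k"
  have \<beta>: "0 \<le> \<beta>" by (simp add: \<beta>_def)
  have "1 \<le> 16 * real n * \<beta> * sqrt (a * \<tau>)"
  \<comment> \<open>If the smallness condition fails, then \<open>n\<close> is already large in
    terms of \<open>a\<close>, and \<open>a \<le> sqrt (a * \<tau>)\<close> finishes.\<close>
  proof (cases "16 * \<beta> * a * real n \<le> 1")
    case True
    have qf: "quad_form k (info_coeff k (sel ys u)) v \<le> a * (\<Sum>i<k. (v i)\<^sup>2)" if "length ys < n" for ys v
    proof -
      have "quad_form k (info_coeff k (sel ys u)) v \<le> op_norm (channel_info_matrix k (sel ys u)) * (\<Sum>i<k. (v i)\<^sup>2)"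
        using k by (rule op_norm_info)
      also have "\<dots> \<le> a * (\<Sum>i<k. (v i)\<^sup>2)"
        using op prot(2)[OF that u(1)] by (intro mult_right_mono sum_nonneg) auto
      finally show ?thesis .
    qed
    have "mix_div n \<le> 32 * (real n * \<beta>)\<^sup>2 * (a * \<tau>)"
      unfolding \<beta>_def using a \<tau> qf tr prot(2)[OF _ u(1)] True by (intro mix_div_le) (auto simp: \<beta>_def)
    also have "\<dots> = 32 * (real n * \<beta> * sqrt (a * \<tau>))\<^sup>2"
      using a \<tau> by (simp add: power_mult_distrib)
    \<comment> \<open>\<open>1/2 \<le> 32 * x^2\<close> is rewritten as
      \<open>1 \<le> (8 * x)^2\<close>.\<close>
    finally have "1\<^sup>2 \<le> (8 * (real n * \<beta> * sqrt (a * \<tau>)))\<^sup>2"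
      using D by (simp only: power_mult_distrib) simp
    then have "1 \<le> 8 * (real n * \<beta> * sqrt (a * \<tau>))"
      using a \<tau> \<beta> by (intro power2_le_imp_le[of 1]) auto
    moreover have "0 \<le> real n * \<beta> * sqrt (a * \<tau>)" using a \<tau> \<beta> by simp
    ultimately show ?thesis by linarith
  next
    case False
    then have "1 \<le> 16 * real n * \<beta> * a" by (simp add: mult_ac)
    also have "\<dots> \<le> 16 * real n * \<beta> * sqrt (a * \<tau>)"
      using sq \<beta> by (intro mult_left_mono) auto
    finally show ?thesis .
  qed
  then have "real k * 1 \<le> real k * (16 * real n * \<beta> * sqrt (a * \<tau>))"
    by (intro mult_left_mono) auto
  then show ?thesis
    using k by (simp add: \<beta>_def)
qed

text \<open>Up to \<open>\<epsilon> = 1/2\<close> the perturbed weights are nonnegative. Some upper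
  limit on \<open>\<epsilon>\<close> is unavoidable: for \<open>\<epsilon> \<ge> 1\<close> no
  distribution is far from uniform, and zero samples suffice.\<close>

theorem theorem6:
  shows "\<exists>c::real. c > 0 \<and>
    (\<forall>(k::nat) (\<epsilon>::real) (\<W> :: nat channel set).
       k \<ge> 1 \<longrightarrow> 0 < \<epsilon> \<longrightarrow> \<epsilon> \<le> 1 / 2 \<longrightarrow>
       ennreal_of_enat (sample_complexity k \<epsilon> \<W>) \<ge>
         ennreal c *
           (of_nat k /
             (ennreal (\<epsilon>\<^sup>2) *
              ennreal_sqrt (family_op_norm k \<W> * family_nuclear_norm k \<W>))))"
proof (intro exI[of _ "1 / 16"] conjI allI impI)
  fix k :: nat and \<epsilon> :: real and \<W> :: "nat channel set"
  assume k: "1 \<le> k" and eps: "0 < \<epsilon>" "\<epsilon> \<le> 1 / 2"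
  define Op where "Op = family_op_norm k \<W>"
  define Nu where "Nu = family_nuclear_norm k \<W>"
  let ?bound = "ennreal (1 / 16) * (of_nat k / (ennreal (\<epsilon>\<^sup>2) * ennreal_sqrt (Op * Nu)))"
  note tr = op_norm_info(1)[OF k] trace_info_le_nuclear_norm[OF k] trace_info_bounds(2)[OF k]
  have "Op \<le> ennreal (2 * real k)"
    unfolding Op_def family_op_norm_def by (intro SUP_least ennreal_leI) (rule order_trans[OF tr(1,3)])
  then have Op_fin: "Op < top_class.top" using ennreal_less_top order_le_less_trans by blast
  have le: "Op \<le> Nu"
    unfolding Op_def Nu_def family_op_norm_def family_nuclear_norm_def
    by (intro SUP_mono' ennreal_leI) (rule order_trans[OF tr(1,2)])
  have opW: "op_norm (channel_info_matrix k W) \<le> enn2real Op" if "W \<in> \<W>" for W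
  proof -
    have "ennreal (op_norm (channel_info_matrix k W)) \<le> Op"
      unfolding Op_def family_op_norm_def using that by (rule SUP_upper)
    then have "enn2real (ennreal (op_norm (channel_info_matrix k W))) \<le> enn2real Op"
      using Op_fin by (rule enn2real_mono)
    then show ?thesis
      by (cases "0 \<le> op_norm (channel_info_matrix k W)") (auto intro: order_trans[OF _ enn2real_nonneg])
  qed
  have bound: "?bound \<le> of_nat n" if test: "uniformity_test k \<epsilon> \<W> n M sel dec"
    for n and M :: "real measure" and sel dec
  proof (cases "Nu = top_class.top")
    case True
    \<comment> \<open>Since \<open>0 * \<infinity> = 0\<close>, a vanishing \<open>Op\<close> would
      make the denominator 0 rather than infinite. It is excluded because a test exists; the trace
      bound \<open>2 * k\<close> stands in for the infinite nuclear norm.\<close>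
    have "Op \<noteq> 0"
    proof
      assume "Op = 0"
      then have "real k \<le> 16 * real n * \<epsilon>\<^sup>2 * sqrt (0 * (2 * real k))"
        using opW tr(3) by (intro uniformity_test_lower_bound[OF k eps test]) auto
      then show False using k by simp
    qed
    then have "ennreal_sqrt (Op * Nu) = top_class.top"
      by (simp add: True ennreal_sqrt_def ennreal_mult_top)
    then show ?thesis
      using eps by (simp add: ennreal_mult_top)
  next
    case False
    then have Nu_fin: "Nu < top_class.top" by (simp add: top.not_eq_extremum)
    define a \<tau> where "a = enn2real Op" and "\<tau> = enn2real Nu"
    have a: "0 \<le> a" "a \<le> \<tau>" and eq: "Op = ennreal a" "Nu = ennreal \<tau>"
      using le Op_fin Nu_fin by (auto simp: a_def \<tau>_def intro: enn2real_mono)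
    have "(\<Sum>i<k. info_coeff k W i i) \<le> \<tau>" if "W \<in> \<W>" for W
    proof -
      have "ennreal (nuclear_norm (channel_info_matrix k W)) \<le> ennreal \<tau>"
        unfolding eq[symmetric] Nu_def family_nuclear_norm_def using that by (rule SUP_upper)
      then have "nuclear_norm (channel_info_matrix k W) \<le> \<tau>"
        using a by (simp add: ennreal_le_iff)
      with tr(2)[of W] show ?thesis by simp
    qed
    then have k_le: "real k \<le> 16 * real n * \<epsilon>\<^sup>2 * sqrt (a * \<tau>)"
      using opW a by (intro uniformity_test_lower_bound[OF k eps test]) (auto simp: a_def)
    define q where "q = \<epsilon>\<^sup>2 * sqrt (a * \<tau>)"
    \<comment> \<open>The existence of a test and \<open>k \<ge> 1\<close> exclude a zero
      denominator, so the quotient is an ordinary real one.\<close>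
    have "q \<noteq> 0" using k_le k by (auto simp: q_def)
    then have q: "0 < q" using a by (simp add: q_def order_less_le)
    have "ennreal_sqrt (Op * Nu) = ennreal (sqrt (a * \<tau>))"
      using a by (simp add: eq ennreal_sqrt_def ennreal_mult'[symmetric])
    then have "ennreal (\<epsilon>\<^sup>2) * ennreal_sqrt (Op * Nu) = ennreal q"
      by (simp add: q_def ennreal_mult')
    then have "?bound = ennreal (1 / 16) * ennreal (real k / q)"
      using q by (simp only: ennreal_of_nat_eq_real_of_nat divide_ennreal of_nat_0_le_iff)
    also have "\<dots> = ennreal (1 / 16 * (real k / q))"
      by (rule ennreal_mult'[symmetric]) simp
    also have "\<dots> \<le> ennreal (real n)"
    proof (rule ennreal_leI)
      have "real k \<le> 16 * real n * q" using k_le by (simp add: q_def mult_ac)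
      then show "1 / 16 * (real k / q) \<le> real n" using q by (simp add: field_simps)
    qed
    finally show ?thesis by (simp add: ennreal_of_nat_eq_real_of_nat)
  qed
  let ?A = "{n. \<exists>(M :: real measure) sel dec. uniformity_test k \<epsilon> \<W> n M sel dec}"
  have "?bound \<le> ennreal_of_enat (sample_complexity k \<epsilon> \<W>)"
  \<comment> \<open>Without any test the complexity is infinite; otherwise the infimum is attained
    by well-ordering, at some \<open>n\<close> covered by \<open>bound\<close>.\<close>
  proof (cases "?A = {}")
    case True
    then show ?thesis by (simp add: sample_complexity_def top_enat_def)
  next
    case False
    then have "Inf (enat ` ?A) \<in> enat ` ?A"
      by (metis (no_types, lifting) ex_in_conv imageI wellorder_InfI)
    then obtain n where "n \<in> ?A" "sample_complexity k \<epsilon> \<W> = enat n"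
      unfolding sample_complexity_def by blast
    then show ?thesis using bound by auto
  qed
  then show "ennreal (1 / 16) * (of_nat k / (ennreal (\<epsilon>\<^sup>2) *
      ennreal_sqrt (family_op_norm k \<W> * family_nuclear_norm k \<W>)))
    \<le> ennreal_of_enat (sample_complexity k \<epsilon> \<W>)"
    by (simp only: Op_def Nu_def)
qed simp

end
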